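(* For every $r\in\mathbb{Z}$ there exist infinitely many totally real quadratic number fields, and infinitely many totally real cubic number fields, over whose ring of integers there is no universal quadratic form of rank $r$.
   Context: For a totally real number field $K$ with ring of integers $R$, a quadratic form of rank $r$ over $R$ is $Q(v_1,\dots,v_r)=\sum_{1\le i\le j\le r}a_{ij}v_iv_j$ with $a_{ij}\in R$; it is universal if it is totally positive definite ($Q(v)$ is totally positive for all nonzero $v\in R^r$) and represents every totally positive element of $R$. *)

theory Defs
  imports Complex_Main "HOL-Algebra.Algebraic_Closure_Type"
begin

text \<open>Number fields are taken as subfields of the complex numbers, which loses nothing up to
  isomorphism.\<close>

abbreviation complex_ring :: "complex ring" where
  "complex_ring \<equiv> ring_of_type_algebra"

abbreviation field_ring :: "complex set \<Rightarrow> complex ring" where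
  "field_ring K \<equiv> complex_ring \<lparr> carrier := K \<rparr>"

definition number_field_of_degree :: "nat \<Rightarrow> complex set \<Rightarrow> bool" where
  "number_field_of_degree d K \<longleftrightarrow>
     subfield K complex_ring \<and> ring.dimension complex_ring d \<rat> K"

text \<open>Homomorphisms are constrained on \<open>K\<close> only, so an embedding occurs here together with
  all of its extensions to functions on the complex numbers. All notions below depend only on
  the values on \<open>K\<close>.\<close>

definition embeddings :: "complex set \<Rightarrow> (complex \<Rightarrow> complex) set" where
  "embeddings K = ring_hom (field_ring K) complex_ring"

definition totally_real :: "complex set \<Rightarrow> bool" where
  "totally_real K \<longleftrightarrow> (\<forall>\<sigma>\<in>embeddings K. \<sigma> ` K \<subseteq> \<real>)"

definition ring_of_integers :: "complex set \<Rightarrow> complex set" where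
  "ring_of_integers K = {x \<in> K. algebraic_int x}"

definition totally_positive :: "complex set \<Rightarrow> complex \<Rightarrow> bool" where
  "totally_positive K x \<longleftrightarrow> x \<in> K \<and> (\<forall>\<sigma>\<in>embeddings K. \<sigma> x \<in> \<real> \<and> Re (\<sigma> x) > 0)"

text \<open>A quadratic form of rank \<open>r\<close> is given by its coefficients \<open>a i j\<close> for
  \<open>1 \<le> i \<le> j \<le> r\<close>; off-diagonal coefficients need not be even. Vectors of length \<open>r\<close>
  are functions of which only the values on \<open>{1..r}\<close> matter.\<close>

definition quadratic_form_over ::
    "complex set \<Rightarrow> nat \<Rightarrow> (nat \<Rightarrow> nat \<Rightarrow> complex) \<Rightarrow> bool" where
  "quadratic_form_over R r a \<longleftrightarrow> (\<forall>i\<in>{1..r}. \<forall>j\<in>{i..r}. a i j \<in> R)"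

definition qf_eval ::
    "nat \<Rightarrow> (nat \<Rightarrow> nat \<Rightarrow> complex) \<Rightarrow> (nat \<Rightarrow> complex) \<Rightarrow> complex" where
  "qf_eval r a v = (\<Sum>i=1..r. \<Sum>j=i..r. a i j * v i * v j)"

definition totally_positive_definite ::
    "complex set \<Rightarrow> nat \<Rightarrow> (nat \<Rightarrow> nat \<Rightarrow> complex) \<Rightarrow> bool" where
  "totally_positive_definite K r a \<longleftrightarrow>
     (\<forall>v \<in> {1..r} \<rightarrow> ring_of_integers K.
        (\<exists>i\<in>{1..r}. v i \<noteq> 0) \<longrightarrow> totally_positive K (qf_eval r a v))"

definition universal_form ::
    "complex set \<Rightarrow> nat \<Rightarrow> (nat \<Rightarrow> nat \<Rightarrow> complex) \<Rightarrow> bool" where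
  "universal_form K r a \<longleftrightarrow>
     quadratic_form_over (ring_of_integers K) r a \<and>
     totally_positive_definite K r a \<and>
     (\<forall>x \<in> ring_of_integers K. totally_positive K x \<longrightarrow>
        (\<exists>v \<in> {1..r} \<rightarrow> ring_of_integers K. qf_eval r a v = x))"

text \<open>The rank parameter may be any integer; for negative \<open>r\<close> there are no forms of rank \<open>r\<close>.\<close>

definition has_universal_form_of_rank :: "complex set \<Rightarrow> int \<Rightarrow> bool" where
  "has_universal_form_of_rank K r \<longleftrightarrow> (\<exists>n a. int n = r \<and> universal_form K n a)"

text \<open>Fields are counted up to isomorphism, not as subsets of the complex numbers.\<close>

definition infinitely_many_fields :: "(complex set \<Rightarrow> bool) \<Rightarrow> bool" where
  "infinitely_many_fields P \<longleftrightarrow>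
     (\<exists>F. infinite F \<and> (\<forall>K\<in>F. P K) \<and>
          pairwise (\<lambda>K L. \<not> field_ring K \<simeq> field_ring L) F)"

end

theory Submission
  imports Defs "Jordan_Normal_Form.Char_Poly" "HOL-Library.Product_Plus"
begin

text \<open>Let \<open>T\<close> be the functional \<open>T x = \<Sum>\<^sub>j (\<sigma>\<^sub>j x - \<sigma>\<^sub>i x)\<close> on a totally real field \<open>K\<close>. It kills the
  rational integers and is positive on elements that are negative at \<open>\<sigma>\<^sub>i\<close> only. If \<open>K\<close> has a unit
  \<open>\<epsilon>\<close> of this signature, then \<open>y \<mapsto> T (\<epsilon> y)\<close> is positive on totally positive elements. Let \<open>l\<close> be an
  irrational integer of \<open>K\<close> for which the integer \<open>d(l) = \<Sum> (\<sigma>\<^sub>i l - \<sigma>\<^sub>j l)\<^sup>2\<close> (up to a constant factor)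
  is minimal, say \<open>d(l) = m\<close>. Then \<open>T (\<epsilon> y) \<ge> \<surd>m\<close> for all totally positive integers \<open>y\<close>, while
  \<open>T (\<epsilon> y) \<le> 2\<surd>m\<close> holds for about \<open>\<surd>m\<close> of them, namely for \<open>y = (l + k) / \<epsilon>\<close> with suitable integers
  \<open>k\<close>. If a form of rank \<open>r\<close> represents them all, and their number exceeds the number of classes of
  vectors modulo 3, then two representing vectors \<open>v\<close>, \<open>v'\<close> are congruent modulo 3, and by the
  parallelogram law \<open>9 T (\<epsilon> Q((v - v') / 3)) \<le> 2 T (\<epsilon> Q(v)) + 2 T (\<epsilon> Q(v')) \<le> 8\<surd>m\<close>, a contradiction.

  Suitable units exist in \<open>\<rat>(\<surd>(q\<^sup>2 + 1))\<close>, where \<open>q + \<surd>(q\<^sup>2 + 1)\<close> has norm \<open>-1\<close>, and in the simplest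
  cubic fields, generated by a root \<open>\<rho>\<close> of \<open>x\<^sup>3 - a x\<^sup>2 - (a + 3) x - 1\<close>, where \<open>\<rho>\<close> and \<open>\<rho> + 1\<close> are units.
  If a prime \<open>p\<close> divides \<open>q\<^sup>2 + 1\<close>, respectively \<open>a\<^sup>2 + 3 a + 9\<close>, exactly once, then it divides \<open>d(x)\<close>
  for every integer \<open>x\<close>, so \<open>m \<ge> p\<close> is large. This also shows that integers with small
  conjugates are rational, which yields infinitely many fields.\<close>

section \<open>Closure of the algebraic integers\<close>

text \<open>Multiplication by \<open>z\<close> acts on the generators \<open>W\<close> through an
  integer matrix. The vector of generators is an eigenvector for \<open>z\<close>, nonzero because 1
  occurs in it, so \<open>z\<close> is a root of the monic integral characteristic
  polynomial.\<close>

lemma algebraic_int_of_stable_lattice: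
  fixes z :: complex
  assumes "finite W" "1 \<in> W"
    and stable: "\<And>w. w \<in> W \<Longrightarrow> \<exists>c :: complex \<Rightarrow> int. z * w = (\<Sum>u\<in>W. of_int (c u) * u)"
  shows "algebraic_int z"
proof -
  obtain ws where ws: "set ws = W" "distinct ws"
    using finite_distinct_list[OF \<open>finite W\<close>] by blast
  obtain c :: "complex \<Rightarrow> complex \<Rightarrow> int"
    where c: "\<And>w. w \<in> W \<Longrightarrow> z * w = (\<Sum>u\<in>W. of_int (c w u) * u)"
    using stable by metis
  define N where "N = length ws"
  define M where "M = mat N N (\<lambda>(i, j). c (ws ! i) (ws ! j))"
  define M' where "M' = map_mat (of_int :: int \<Rightarrow> complex) M"
  define v where "v = vec N (\<lambda>i. ws ! i)"
  have M: "M \<in> carrier_mat N N" and M': "M' \<in> carrier_mat N N" and v: "v \<in> carrier_vec N"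
    by (auto simp: M_def M'_def v_def)
  have "M' *\<^sub>v v = z \<cdot>\<^sub>v v"
  proof (rule eq_vecI)
    fix i assume "i < dim_vec (z \<cdot>\<^sub>v v)"
    then have i: "i < N" by (simp add: v_def)
    have "vec_index (M' *\<^sub>v v) i = (\<Sum>j = 0..<N. of_int (c (ws ! i) (ws ! j)) * ws ! j)"
      using i by (simp add: M'_def M_def v_def scalar_prod_def)
    also have "\<dots> = (\<Sum>u\<in>W. of_int (c (ws ! i) u) * u)"
      unfolding ws(1)[symmetric] N_def
      by (rule sum.reindex_bij_betw) (use bij_betw_nth[OF ws(2)] in \<open>auto simp: atLeast0LessThan\<close>)
    also have "\<dots> = z * ws ! i"
      using c[of "ws ! i"] nth_mem[of i ws] i ws(1) by (simp add: N_def)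
    finally show "vec_index (M' *\<^sub>v v) i = vec_index (z \<cdot>\<^sub>v v) i"
      using i by (simp add: v_def)
  qed (use M' in \<open>auto simp: v_def\<close>)
  moreover have "v \<noteq> 0\<^sub>v N"
  proof -
    obtain i where i: "i < N" "ws ! i = 1"
      using \<open>1 \<in> W\<close> ws(1) by (metis N_def in_set_conv_nth)
    then have "vec_index v i \<noteq> vec_index (0\<^sub>v N) i" by (simp add: v_def)
    then show ?thesis by metis
  qed
  ultimately have "eigenvalue M' z"
    unfolding eigenvalue_def eigenvector_def using v M' by auto
  then have "poly (char_poly M') z = 0"
    using eigenvalue_root_char_poly[OF M'] by simp
  moreover have "char_poly M' = map_poly of_int (char_poly M)"
    unfolding M'_def by (rule of_int_hom.char_poly_hom[OF M])
  ultimately show ?thesis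
    unfolding algebraic_int_altdef_ipoly
    using degree_monic_char_poly[OF M] by auto
qed

lemma algebraic_int_obtain_power:
  fixes x :: complex
  assumes "algebraic_int x"
  obtains n and c :: "nat \<Rightarrow> int" where "n > 0" "x ^ n = (\<Sum>i<n. of_int (c i) * x ^ i)"
proof -
  obtain p where p: "poly (map_poly of_int p) x = 0" "lead_coeff p = 1"
    using assms unfolding algebraic_int_altdef_ipoly by blast
  define n where "n = degree p"
  have "poly (map_poly of_int p) x = (\<Sum>i\<le>n. of_int (coeff p i) * x ^ i)"
    by (simp add: poly_altdef n_def coeff_map_poly degree_map_poly)
  also have "\<dots> = (\<Sum>i<n. of_int (coeff p i) * x ^ i) + x ^ n"
    using p(2) by (simp add: n_def flip: lessThan_Suc_atMost)
  finally have eq: "x ^ n = (\<Sum>i<n. of_int (- coeff p i) * x ^ i)"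
    using p(1) by (simp add: sum_negf eq_neg_iff_add_eq_0 add.commute)
  \<comment> \<open>With \<open>n = 0\<close> the relation would read 1 = 0. Positivity later puts 1
    among the monomials.\<close>
  have "n > 0" using eq by (cases n) auto
  then show thesis using eq by (rule that)
qed

definition int_span :: "complex set \<Rightarrow> complex set" where
  "int_span W = {x. \<exists>c :: complex \<Rightarrow> int. x = (\<Sum>u\<in>W. of_int (c u) * u)}"

lemma int_span_base: "finite W \<Longrightarrow> w \<in> W \<Longrightarrow> w \<in> int_span W"
  unfolding int_span_def
  by (intro CollectI exI[of _ "\<lambda>u. if u = w then 1 else 0"])
     (simp add: if_distrib[of of_int] if_distrib[of "\<lambda>x. x * _"] cong: if_cong)

lemma int_span_add: "x \<in> int_span W \<Longrightarrow> y \<in> int_span W \<Longrightarrow> x + y \<in> int_span W"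
  unfolding int_span_def
proof clarify
  fix c d :: "complex \<Rightarrow> int"
  show "\<exists>e :: complex \<Rightarrow> int. (\<Sum>u\<in>W. of_int (c u) * u) + (\<Sum>u\<in>W. of_int (d u) * u) = (\<Sum>u\<in>W. of_int (e u) * u)"
    by (intro exI[of _ "\<lambda>u. c u + d u"]) (simp add: sum.distrib algebra_simps)
qed

lemma int_span_scale: "x \<in> int_span W \<Longrightarrow> of_int k * x \<in> int_span W"
  unfolding int_span_def
proof clarify
  fix c :: "complex \<Rightarrow> int"
  show "\<exists>e :: complex \<Rightarrow> int. of_int k * (\<Sum>u\<in>W. of_int (c u) * u) = (\<Sum>u\<in>W. of_int (e u) * u)"
    by (intro exI[of _ "\<lambda>u. k * c u"]) (simp add: sum_distrib_left mult.assoc)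
qed

lemma int_span_sum:
  "(\<And>i. i \<in> I \<Longrightarrow> f i \<in> int_span W) \<Longrightarrow> sum f I \<in> int_span W"
proof (induction I rule: infinite_finite_induct)
  case (insert i I)
  then show ?case by (simp add: int_span_add)
qed (simp_all add: int_span_def exI[of _ "\<lambda>_. 0"])

lemma int_span_mult_closed:
  assumes "\<And>w. w \<in> W \<Longrightarrow> z * w \<in> int_span W" "x \<in> int_span W"
  shows "z * x \<in> int_span W"
proof -
  obtain c :: "complex \<Rightarrow> int" where "x = (\<Sum>u\<in>W. of_int (c u) * u)"
    using assms(2) unfolding int_span_def by blast
  then have "z * x = (\<Sum>u\<in>W. of_int (c u) * (z * u))"
    by (simp add: sum_distrib_left mult_ac)
  then show ?thesis using assms(1) by (simp add: int_span_sum int_span_scale)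
qed

text \<open>The monomials \<open>x ^ i * y ^ j\<close> below the degrees of the two monic relations
  generate a lattice that contains 1 and is stable under multiplication by \<open>x\<close> and by
  \<open>y\<close>, hence by \<open>x + y\<close> and \<open>x * y\<close>.\<close>

lemma algebraic_int_add_mult:
  fixes x y :: complex
  assumes "algebraic_int x" "algebraic_int y"
  shows "algebraic_int (x + y)" "algebraic_int (x * y)"
proof -
  obtain m c where m: "m > 0" "x ^ m = (\<Sum>i<m. of_int (c i :: int) * x ^ i)"
    using algebraic_int_obtain_power[OF assms(1)] by blast
  obtain n d where n: "n > 0" "y ^ n = (\<Sum>i<n. of_int (d i :: int) * y ^ i)"
    using algebraic_int_obtain_power[OF assms(2)] by blast
  define W where "W = (\<lambda>(i, j). x ^ i * y ^ j) ` ({..<m} \<times> {..<n})"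
  have fin: "finite W" unfolding W_def by simp
  have base: "x ^ i * y ^ j \<in> int_span W" if "i < m" "j < n" for i j
    by (rule int_span_base[OF fin]) (use that in \<open>auto simp: W_def\<close>)
  have "1 \<in> W" unfolding W_def using m(1) n(1) by (auto intro!: image_eqI[of _ _ "(0, 0)"])
  have X: "x * w \<in> int_span W" if "w \<in> W" for w
  proof -
    obtain i j where w: "w = x ^ i * y ^ j" "i < m" "j < n" using \<open>w \<in> W\<close> unfolding W_def by auto
    show ?thesis
    proof (cases "Suc i < m")
      case True
      then show ?thesis using base[of "Suc i" j] w by (simp add: mult_ac)
    next
      case False
      \<comment> \<open>Only here does the exponent leave the range; the monic relation for
        \<open>x ^ m\<close> brings it back.\<close>
      then have "Suc i = m" using w by simp
      then have "x * w = x ^ m * y ^ j" using w by (auto simp: mult_ac)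
      also have "\<dots> = (\<Sum>i<m. of_int (c i) * (x ^ i * y ^ j))"
        unfolding m(2) sum_distrib_right by (simp only: mult.assoc)
      finally show ?thesis using w by (auto intro!: int_span_sum int_span_scale base)
    qed
  qed
  have Y: "y * w \<in> int_span W" if "w \<in> W" for w
  proof -
    obtain i j where w: "w = x ^ i * y ^ j" "i < m" "j < n" using \<open>w \<in> W\<close> unfolding W_def by auto
    show ?thesis
    proof (cases "Suc j < n")
      case True
      then show ?thesis using base[of i "Suc j"] w by (simp add: mult_ac)
    next
      case False
      then have "Suc j = n" using w by simp
      then have "y * w = x ^ i * y ^ n" using w by (auto simp: mult_ac)
      also have "\<dots> = (\<Sum>j<n. of_int (d j) * (x ^ i * y ^ j))"
        unfolding n(2) sum_distrib_left by (simp only: mult.left_commute)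
      finally show ?thesis using w by (auto intro!: int_span_sum int_span_scale base)
    qed
  qed
  have criterion: "algebraic_int z" if "\<And>w. w \<in> W \<Longrightarrow> z * w \<in> int_span W" for z
    using algebraic_int_of_stable_lattice[OF fin \<open>1 \<in> W\<close>, of z] that unfolding int_span_def by blast
  show "algebraic_int (x + y)"
    by (rule criterion) (simp add: distrib_right int_span_add X Y)
  show "algebraic_int (x * y)"
    by (rule criterion) (simp add: mult.assoc int_span_mult_closed X Y)
qed

section \<open>Residue classes modulo 3\<close>

definition additive_subgroup_set :: "'a::ab_group_add set \<Rightarrow> bool" where
  "additive_subgroup_set G \<longleftrightarrow> 0 \<in> G \<and> (\<forall>x\<in>G. \<forall>y\<in>G. x - y \<in> G)"

text \<open>The quotient G/3G has at most \<open>k\<close> elements. The triple of \<open>z\<close>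
  is spelled \<open>z + z + z\<close> because the type is only an additive group.\<close>

definition reps_mod3 :: "'a::ab_group_add set \<Rightarrow> nat \<Rightarrow> bool" where
  "reps_mod3 G k \<longleftrightarrow>
     (\<exists>R\<subseteq>G. finite R \<and> card R \<le> k \<and> (\<forall>x\<in>G. \<exists>r\<in>R. \<exists>z\<in>G. x = r + (z + z + z)))"

lemma additive_subgroup_setD:
  assumes "additive_subgroup_set G"
  shows "0 \<in> G" "x \<in> G \<Longrightarrow> y \<in> G \<Longrightarrow> x - y \<in> G" "x \<in> G \<Longrightarrow> y \<in> G \<Longrightarrow> x + y \<in> G" "x \<in> G \<Longrightarrow> - x \<in> G"
proof -
  show 0: "0 \<in> G" and diff: "x \<in> G \<Longrightarrow> y \<in> G \<Longrightarrow> x - y \<in> G" for x y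
    using assms unfolding additive_subgroup_set_def by auto
  show minus: "- x \<in> G" if "x \<in> G" for x using diff[OF 0 that] by simp
  show "x \<in> G \<Longrightarrow> y \<in> G \<Longrightarrow> x + y \<in> G" using diff[OF _ minus, of x y] by simp
qed

lemma additive_subgroup_set_of_int_mult:
  fixes x :: "'a::ring_1"
  assumes "additive_subgroup_set G" "x \<in> G"
  shows "of_int k * x \<in> G"
proof (induction k rule: int_induct[where k = 0])
  case base
  then show ?case using additive_subgroup_setD[OF assms(1)] by simp
next
  case (step1 i)
  then show ?case using additive_subgroup_setD(3)[OF assms(1)] assms(2) by (simp add: distrib_right)
next
  case (step2 i)
  then show ?case using additive_subgroup_setD(2)[OF assms(1)] assms(2) by (simp add: left_diff_distrib)
qed

lemma reps_mod3_zero: "reps_mod3 {0} 1"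
  unfolding reps_mod3_def by (intro exI[of _ "{0}"]) auto

text \<open>Right exactness of reduction modulo 3: after a lift of the class of \<open>f x\<close>
  and a triple have been subtracted, what remains of \<open>x\<close> lies in the kernel. Sums of
  lifts and kernel representatives therefore cover \<open>G\<close>.\<close>

lemma reps_mod3_exact:
  assumes G: "additive_subgroup_set G"
    and f: "\<And>x y. x \<in> G \<Longrightarrow> y \<in> G \<Longrightarrow> f (x - y) = f x - f y"
    and image: "reps_mod3 (f ` G) k" and kernel: "reps_mod3 {x\<in>G. f x = 0} l"
  shows "reps_mod3 G (k * l)"
proof -
  note closed = additive_subgroup_setD[OF G]
  have f0: "f 0 = 0" using f[OF closed(1) closed(1)] by simp
  have f_minus: "f (- x) = - f x" if "x \<in> G" for x
    using f[OF closed(1) that] f0 by simp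
  have f_add: "f (x + y) = f x + f y" if "x \<in> G" "y \<in> G" for x y
    using f[OF that(1) closed(4)[OF that(2)]] f_minus[OF that(2)] by simp
  obtain R where R: "R \<subseteq> f ` G" "finite R" "card R \<le> k"
    and R_reps: "\<forall>x\<in>f ` G. \<exists>r\<in>R. \<exists>z\<in>f ` G. x = r + (z + z + z)"
    using image unfolding reps_mod3_def by (elim exE conjE) (rule that; assumption)
  obtain S where S: "S \<subseteq> {x\<in>G. f x = 0}" "finite S" "card S \<le> l"
    and S_reps: "\<forall>x\<in>{x\<in>G. f x = 0}. \<exists>r\<in>S. \<exists>z\<in>{x\<in>G. f x = 0}. x = r + (z + z + z)"
    using kernel unfolding reps_mod3_def by (elim exE conjE) (rule that; assumption)
  obtain g where g: "\<And>y. y \<in> R \<Longrightarrow> g y \<in> G \<and> f (g y) = y"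
  proof -
    have "\<forall>y\<in>R. \<exists>x. x \<in> G \<and> f x = y" using R(1) by blast
    then show thesis using that by metis
  qed
  let ?P = "(\<lambda>(y, u). g y + u) ` (R \<times> S)"
  have "?P \<subseteq> G" using g S(1) closed(3) by auto
  moreover have "finite ?P" using R(2) S(2) by simp
  moreover have "card ?P \<le> k * l"
    using card_image_le[of "R \<times> S" "\<lambda>(y, u). g y + u"] R S
    by (simp add: card_cartesian_product) (meson le_trans mult_le_mono)
  moreover have "\<exists>r\<in>?P. \<exists>z\<in>G. x = r + (z + z + z)" if x: "x \<in> G" for x
  proof -
    obtain y z where y: "y \<in> R" and z: "z \<in> G" and fx: "f x = y + (f z + f z + f z)"
      using R_reps x by blast
    define w where "w = x - g y - (z + z + z)"
    have "w \<in> G" unfolding w_def by (intro closed(2,3) x z conjunct1[OF g[OF y]])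
    moreover have "f w = 0"
      unfolding w_def by (simp add: f f_add fx closed(2,3) x z g[OF y])
    ultimately obtain u t where u: "u \<in> S" and t: "t \<in> G" and w: "w = u + (t + t + t)"
      using bspec[OF S_reps, of w] by auto
    have "x = (g y + u) + ((z + t) + (z + t) + (z + t))"
      using w unfolding w_def by (simp add: algebra_simps)
    moreover have "g y + u \<in> ?P" using y u by force
    moreover have "z + t \<in> G" by (rule closed(3)[OF z t])
    ultimately show ?thesis by blast
  qed
  ultimately show ?thesis unfolding reps_mod3_def by blast
qed

text \<open>Subgroups of the rationals are locally cyclic. If \<open>h\<close> is not a triple, then
  any \<open>x\<close> lies with \<open>h\<close> in a cyclic group generated by some
  \<open>g\<close> in \<open>H\<close>, where \<open>h\<close> is a multiple of \<open>g\<close>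
  prime to 3; so \<open>x\<close> is congruent to 0, \<open>h\<close> or
  \<open>2 * h\<close>.\<close>

lemma reps_mod3_rat:
  fixes H :: "rat set"
  assumes H: "additive_subgroup_set H"
  shows "reps_mod3 H 3"
proof (cases "\<exists>h\<in>H. \<forall>z\<in>H. h \<noteq> z + z + z")
  case False
  then have "\<forall>x\<in>H. \<exists>r\<in>{0}. \<exists>z\<in>H. x = r + (z + z + z)" by auto
  then show ?thesis
    unfolding reps_mod3_def using additive_subgroup_setD(1)[OF H] by (intro exI[of _ "{0}"]) auto
next
  case True
  then obtain h where h: "h \<in> H" and not3: "\<And>z. z \<in> H \<Longrightarrow> h \<noteq> z + z + z" by blast
  note closed = additive_subgroup_setD[OF H]
  note scale = additive_subgroup_set_of_int_mult[OF H]
  have "h \<noteq> 0" using not3[OF closed(1)] by auto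
  let ?R = "(\<lambda>j::int. of_int j * h) ` {0..<3}"
  have "\<exists>r\<in>?R. \<exists>z\<in>H. x = r + (z + z + z)" if x: "x \<in> H" for x
  proof -
    obtain w u where q: "x / h = of_int w / of_int u" and "u > 0" and cop: "coprime w u"
      using quotient_of_div[of "x / h" "fst (quotient_of (x / h))" "snd (quotient_of (x / h))"]
        quotient_of_denom_pos'[of "x / h"] quotient_of_coprime[of "x / h"]
      by (metis prod.collapse)
    obtain c d where cd: "c * w + d * u = 1"
      using bezout_int[of w u] cop by (auto simp: coprime_iff_gcd_eq_1)
    \<comment> \<open>By Bezout \<open>g\<close> is an integral combination of \<open>x\<close> and
      \<open>h\<close>, which puts it in \<open>H\<close>.\<close>
    define g where "g = h / of_int u"
    have xg: "x = of_int w * g" using q \<open>h \<noteq> 0\<close> unfolding g_def by (simp add: field_simps)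
    have hg: "h = of_int u * g" using \<open>u > 0\<close> unfolding g_def by simp
    have "g = of_int (c * w + d * u) * g" by (simp add: cd)
    also have "\<dots> = of_int c * x + of_int d * h" by (simp add: xg hg algebra_simps)
    finally have g: "g \<in> H" using closed(3)[OF scale[OF x, of c] scale[OF h, of d]] by simp
    have "\<not> 3 dvd u"
    proof
      assume "3 dvd u"
      then obtain u' where "u = 3 * u'" by blast
      then have "h = of_int u' * g + of_int u' * g + of_int u' * g" using hg by simp
      then show False using not3 scale[OF g] by blast
    qed
    \<comment> \<open>Modulo 3, \<open>u\<close> is its own inverse, so \<open>j\<close> is the
      residue of \<open>u * w\<close>, that is, of \<open>w\<close> or of
      \<open>2 * w\<close>.\<close>
    have "\<exists>j\<in>{0..<3}. 3 dvd w - j * u"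
    proof -
      have "u mod 3 = 1 \<or> u mod 3 = 2" using \<open>\<not> 3 dvd u\<close> by presburger
      then show ?thesis
      proof
        assume "u mod 3 = 1"
        moreover obtain e where "u = 3 * e + u mod 3" by (metis mult_div_mod_eq)
        ultimately have e: "u = 3 * e + 1" by simp
        obtain d m where m: "w = 3 * d + m" "m \<in> {0..<3}"
          using that[of "w div 3" "w mod 3"] by simp
        have "w - m * u = 3 * (d - m * e)" unfolding e m(1) by (simp add: algebra_simps)
        then have "3 dvd w - m * u" by (rule dvdI)
        then show ?thesis using m(2) by (rule bexI)
      next
        assume "u mod 3 = 2"
        moreover obtain e where "u = 3 * e + u mod 3" by (metis mult_div_mod_eq)
        ultimately have e: "u = 3 * e + 2" by simp
        obtain d m where m: "2 * w = 3 * d + m" "m \<in> {0..<3}"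
          using that[of "2 * w div 3" "2 * w mod 3"] by simp
        have "w - m * u = 3 * (2 * d - w - m * e)"
          using m(1) unfolding e by (simp add: algebra_simps)
        then have "3 dvd w - m * u" by (rule dvdI)
        then show ?thesis using m(2) by (rule bexI)
      qed
    qed
    then obtain j e where j: "j \<in> {0..<3}" and e: "w - j * u = 3 * e" by blast
    have "x - of_int j * h = of_int (w - j * u) * g" by (simp add: xg hg algebra_simps)
    also have "\<dots> = of_int e * g + of_int e * g + of_int e * g" by (simp add: e)
    finally have "x = of_int j * h + (of_int e * g + of_int e * g + of_int e * g)" by simp
    then show ?thesis using j scale[OF g] by blast
  qed
  moreover have "card ?R \<le> 3" using card_image_le[of "{0..<3::int}" "\<lambda>j. of_int j * h"] by simp
  ultimately show ?thesis
    unfolding reps_mod3_def using scale[OF h] by (intro exI[of _ ?R]) auto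
qed

section \<open>Identities for quadratic forms\<close>

lemma qf_eval_cong: "(\<And>i. i \<in> {1..r} \<Longrightarrow> v i = w i) \<Longrightarrow> qf_eval r a v = qf_eval r a w"
  unfolding qf_eval_def by (intro sum.cong) auto

lemma qf_eval_parallelogram:
  "qf_eval r a (\<lambda>i. v i + w i) + qf_eval r a (\<lambda>i. v i - w i) = 2 * qf_eval r a v + 2 * qf_eval r a w"
proof -
  have "a i j * (v i + w i) * (v j + w j) + a i j * (v i - w i) * (v j - w j)
      = 2 * (a i j * v i * v j) + 2 * (a i j * w i * w j)" for i j
    by (simp add: algebra_simps)
  then show ?thesis
    unfolding qf_eval_def sum_distrib_left by (simp flip: sum.distrib)
qed

lemma qf_eval_scale: "qf_eval r a (\<lambda>i. c * v i) = c\<^sup>2 * qf_eval r a v"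
  unfolding qf_eval_def sum_distrib_left by (simp add: power2_eq_square mult_ac)

section \<open>The pigeonhole argument\<close>

lemma subfield_complex_closed:
  assumes "subfield K complex_ring"
  shows "0 \<in> K" "1 \<in> K" "x \<in> K \<Longrightarrow> y \<in> K \<Longrightarrow> x + y \<in> K" "x \<in> K \<Longrightarrow> y \<in> K \<Longrightarrow> x * y \<in> K"
    "x \<in> K \<Longrightarrow> - x \<in> K"
proof -
  interpret R: ring complex_ring by (rule ring_from_type_algebra)
  note sub = subfieldE(1)[OF assms]
  show "0 \<in> K" "1 \<in> K" "x \<in> K \<Longrightarrow> y \<in> K \<Longrightarrow> x + y \<in> K" "x \<in> K \<Longrightarrow> y \<in> K \<Longrightarrow> x * y \<in> K"
    using subringE[OF sub] by (simp_all add: ring_of_type_algebra_def)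
  have "a_inv complex_ring x = - x"
    by (rule R.minus_equality) (auto simp: ring_of_type_algebra_def)
  then show "x \<in> K \<Longrightarrow> - x \<in> K" using subringE(5)[OF sub, of x] by simp
qed

text \<open>The functions \<open>s j\<close> list all embeddings of \<open>K\<close>, with real
  values. They are compared on \<open>K\<close> only, because \<open>embeddings K\<close> contains
  every extension of an embedding to the complex numbers.\<close>

locale real_embeddings =
  fixes K :: "complex set" and J :: "nat set" and s :: "nat \<Rightarrow> complex \<Rightarrow> real"
  assumes subfield: "subfield K complex_ring"
    and finite_J: "finite J"
    and embedding: "\<And>j. j \<in> J \<Longrightarrow> (\<lambda>x. complex_of_real (s j x)) \<in> embeddings K"
    and embedding_cases: "\<And>\<tau>. \<tau> \<in> embeddings K \<Longrightarrow> \<exists>j\<in>J. \<forall>x\<in>K. \<tau> x = complex_of_real (s j x)"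
begin

abbreviation "O_K \<equiv> ring_of_integers K"

lemmas K_closed = subfield_complex_closed[OF subfield]

lemma int_in_K: "of_int k \<in> K"
proof (induction k rule: int_induct[where k = 0])
  case (step2 i)
  then show ?case using K_closed(3)[OF _ K_closed(5)[OF K_closed(2)], of "of_int i"] by simp
qed (use K_closed in auto)

lemma s_hom:
  assumes "j \<in> J"
  shows "x \<in> K \<Longrightarrow> y \<in> K \<Longrightarrow> s j (x + y) = s j x + s j y"
    "x \<in> K \<Longrightarrow> y \<in> K \<Longrightarrow> s j (x * y) = s j x * s j y"
    "s j 1 = 1" "s j 0 = 0" "x \<in> K \<Longrightarrow> s j (- x) = - s j x"
    "x \<in> K \<Longrightarrow> y \<in> K \<Longrightarrow> s j (x - y) = s j x - s j y"
proof -
  note h = embedding[OF assms, unfolded embeddings_def]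
  show add: "s j (x + y) = s j x + s j y" if "x \<in> K" "y \<in> K" for x y
    using ring_hom_add[OF h, of x y] that
    by (simp add: ring_of_type_algebra_def flip: of_real_add)
  show "s j (x * y) = s j x * s j y" if "x \<in> K" "y \<in> K" for x y
    using ring_hom_mult[OF h, of x y] that
    by (simp add: ring_of_type_algebra_def flip: of_real_mult)
  show "s j 1 = 1"
    using ring_hom_one[OF h] by (simp add: ring_of_type_algebra_def)
  show zero: "s j 0 = 0" using add[OF K_closed(1) K_closed(1)] by simp
  show minus: "s j (- x) = - s j x" if "x \<in> K" for x
    using add[OF that K_closed(5)[OF that]] zero by simp
  show "s j (x - y) = s j x - s j y" if "x \<in> K" "y \<in> K" for x y
    using add[OF that(1) K_closed(5)[OF that(2)]] minus[OF that(2)] by simp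
qed

lemma s_of_int:
  assumes "j \<in> J"
  shows "s j (of_int k) = of_int k"
proof (induction k rule: int_induct[where k = 0])
  case (step2 i)
  then show ?case using s_hom(6)[OF assms int_in_K K_closed(2), of i] s_hom(3)[OF assms] by simp
next
  case (step1 i)
  then show ?case using s_hom(1)[OF assms int_in_K K_closed(2), of i] s_hom(3)[OF assms] by simp
qed (use s_hom(4)[OF assms] in simp)

lemma totally_real: "totally_real K"
  unfolding totally_real_def using embedding_cases by fastforce

lemma totally_positive_iff: "totally_positive K x \<longleftrightarrow> x \<in> K \<and> (\<forall>j\<in>J. 0 < s j x)"
proof
  assume "totally_positive K x"
  then show "x \<in> K \<and> (\<forall>j\<in>J. 0 < s j x)"
    unfolding totally_positive_def using embedding by fastforce
next
  assume x: "x \<in> K \<and> (\<forall>j\<in>J. 0 < s j x)"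
  then show "totally_positive K x"
    unfolding totally_positive_def using embedding_cases by fastforce
qed

lemma O_closed:
  shows "x \<in> O_K \<Longrightarrow> x \<in> K"
    "x \<in> O_K \<Longrightarrow> y \<in> O_K \<Longrightarrow> x + y \<in> O_K"
    "x \<in> O_K \<Longrightarrow> y \<in> O_K \<Longrightarrow> x * y \<in> O_K"
    "x \<in> O_K \<Longrightarrow> - x \<in> O_K"
    "x \<in> O_K \<Longrightarrow> y \<in> O_K \<Longrightarrow> x - y \<in> O_K"
    "of_int k \<in> O_K"
proof -
  show "x \<in> O_K \<Longrightarrow> x \<in> K" by (simp add: ring_of_integers_def)
  show add: "x \<in> O_K \<Longrightarrow> y \<in> O_K \<Longrightarrow> x + y \<in> O_K" for x y
    by (simp add: ring_of_integers_def algebraic_int_add_mult K_closed)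
  show "x \<in> O_K \<Longrightarrow> y \<in> O_K \<Longrightarrow> x * y \<in> O_K"
    by (simp add: ring_of_integers_def algebraic_int_add_mult K_closed)
  show minus: "x \<in> O_K \<Longrightarrow> - x \<in> O_K" for x
    by (simp add: ring_of_integers_def K_closed)
  show "x \<in> O_K \<Longrightarrow> y \<in> O_K \<Longrightarrow> x - y \<in> O_K" using add[OF _ minus, of x y] by simp
  show "of_int k \<in> O_K" by (simp add: ring_of_integers_def int_in_K)
qed

lemma subgroup_O: "additive_subgroup_set O_K"
  unfolding additive_subgroup_set_def using O_closed(5) O_closed(6)[of 0] by simp

lemma O_sum: "(\<And>i. i \<in> I \<Longrightarrow> f i \<in> O_K) \<Longrightarrow> sum f I \<in> O_K"
  by (induction I rule: infinite_finite_induct) (use O_closed(6)[of 0] O_closed(2) in auto)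

lemma qf_eval_in_O:
  assumes "quadratic_form_over O_K r a" "v \<in> {1..r} \<rightarrow> O_K"
  shows "qf_eval r a v \<in> O_K"
  unfolding qf_eval_def using assms
  by (auto intro!: O_sum O_closed(3) simp: quadratic_form_over_def)

lemma s_poly_int:
  assumes "j \<in> J" "x \<in> K"
  shows "poly (map_poly of_int p) x \<in> K \<and>
    s j (poly (map_poly of_int p) x) = poly (map_poly of_int p) (s j x)"
proof (induction p)
  case 0
  then show ?case using K_closed s_hom[OF assms(1)] by simp
next
  case (pCons c p)
  then show ?case
    using K_closed s_hom[OF assms(1)] s_of_int[OF assms(1)] int_in_K assms(2)
    by (simp add: map_poly_pCons)
qed

lemma algebraic_int_s:
  assumes "j \<in> J" "x \<in> O_K"
  shows "algebraic_int (s j x)"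
proof -
  have x: "x \<in> K" "algebraic_int x" using assms(2) by (auto simp: ring_of_integers_def)
  then obtain p where "poly (map_poly of_int p) x = 0" "lead_coeff p = 1"
    unfolding algebraic_int_altdef_ipoly by blast
  then show ?thesis
    using s_poly_int[OF assms(1) x(1), of p] s_hom(4)[OF assms(1)]
    unfolding algebraic_int_altdef_ipoly by auto
qed

text \<open>The number \<open>c ^ r\<close> bounds the classes of vectors modulo 3, and the gap at
  \<open>l\<close> supplies \<open>N\<close> translates of \<open>l\<close> with the signature of
  \<open>\<epsilon>\<close>. Two of the vectors representing their quotients by
  \<open>\<epsilon>\<close> agree modulo 3, and a third of the difference takes a value too small
  for the lower bound \<open>\<mu>\<close>.\<close>

lemma no_universal_form:
  assumes i: "i \<in> J" and units: "\<epsilon> \<in> O_K" "\<delta> \<in> O_K" "\<epsilon> * \<delta> = 1"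
    and \<epsilon>: "s i \<epsilon> < 0" "\<And>j. j \<in> J - {i} \<Longrightarrow> 0 < s j \<epsilon>"
    and T_def: "T = (\<lambda>x. \<Sum>j\<in>J. s j x - s i x)"
    and l: "l \<in> O_K" "T l \<le> 2 * \<mu>" "\<And>j. j \<in> J - {i} \<Longrightarrow> real N < s j l - s i l"
    and \<mu>: "0 < \<mu>"
      "\<And>x. x \<in> O_K \<Longrightarrow> s i x < 0 \<Longrightarrow> (\<And>j. j \<in> J - {i} \<Longrightarrow> 0 < s j x) \<Longrightarrow> \<mu> \<le> T x"
    and reps: "reps_mod3 O_K c" and N: "c ^ r < N"
  shows "\<not> universal_form K r a"
proof
  assume univ: "universal_form K r a"
  \<comment> \<open>\<open>k0\<close> is the largest integer with \<open>s i l + k0 < 0\<close>, so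
    this sum is at least -1. For \<open>t < N\<close> the shift by \<open>k0 - t\<close> leaves the
    \<open>i\<close>-th conjugate negative but at least \<open>- 1 - t\<close>, and the gap of more
    than \<open>N\<close> makes the others positive.\<close>
  define k0 where "k0 = \<lceil>- s i l\<rceil> - 1"
  define x where "x t = l + of_int (k0 - int t)" for t
  have xO: "x t \<in> O_K" for t
    unfolding x_def using O_closed(2)[OF l(1) O_closed(6)] .
  have sx: "s j (x t) = s j l + of_int (k0 - int t)" if "j \<in> J" for j t
    unfolding x_def using s_hom(1)[OF that O_closed(1)[OF l(1)] int_in_K] s_of_int[OF that]
    by (simp del: of_int_diff)
  have k0: "real_of_int k0 < - s i l" "- s i l \<le> real_of_int k0 + 1"
    unfolding k0_def by linarith+
  have x_neg: "s i (x t) < 0" for t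
    using sx[OF i, of t] k0 by simp
  have x_pos: "0 < s j (x t)" if "t < N" "j \<in> J - {i}" for j t
  proof -
    have "real t \<le> real N - 1" using that(1) by linarith
    then show ?thesis using sx[of j t] that k0 l(3)[OF that(2)] by simp
  qed
  have unit: "s j \<epsilon> * s j \<delta> = 1" if "j \<in> J" for j
    using s_hom(2)[OF that, of \<epsilon> \<delta>] s_hom(3)[OF that] O_closed(1) units by simp
  \<comment> \<open>This is the quotient of \<open>x t\<close> by the unit
    \<open>\<epsilon>\<close>. For \<open>t < N\<close> both have the same sign at every embedding,
    so it is totally positive.\<close>
  define \<alpha> where "\<alpha> t = \<delta> * x t" for t
  have \<alpha>O: "\<alpha> t \<in> O_K" for t unfolding \<alpha>_def by (rule O_closed(3)[OF units(2) xO])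
  have \<epsilon>\<alpha>: "\<epsilon> * \<alpha> t = x t" for t
    unfolding \<alpha>_def using units(3) by (simp flip: mult.assoc)
  have \<alpha>_pos: "totally_positive K (\<alpha> t)" if "t < N" for t
    unfolding totally_positive_iff
  proof (intro conjI ballI)
    show "\<alpha> t \<in> K" by (rule O_closed(1)[OF \<alpha>O])
    fix j assume j: "j \<in> J"
    have "s j (x t) = s j \<epsilon> * s j (\<alpha> t)"
      using s_hom(2)[OF j O_closed(1)[OF units(1)] O_closed(1)[OF \<alpha>O]] \<epsilon>\<alpha> by metis
    moreover have "s j \<epsilon> < 0 \<and> s j (x t) < 0 \<or> 0 < s j \<epsilon> \<and> 0 < s j (x t)"
      using j \<epsilon> x_neg x_pos[OF that] by (cases "j = i") auto
    ultimately show "0 < s j (\<alpha> t)"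
      by (auto simp: mult_less_0_iff zero_less_mult_iff)
  qed
  have T_add: "T (y + z) = T y + T z" if "y \<in> K" "z \<in> K" for y z
    unfolding T_def using that i by (simp add: s_hom(1) sum.distrib algebra_simps sum_subtractf)
  have T_scale: "T (of_int k * y) = of_int k * T y" if "y \<in> K" for y k
    unfolding T_def sum_distrib_left using that i
    by (intro sum.cong) (simp_all add: s_hom(2) s_of_int int_in_K algebra_simps)
  have T_int: "T (of_int k) = 0" for k
    unfolding T_def using i by (simp add: s_of_int)
  \<comment> \<open>On totally positive integers \<open>U\<close> is at least \<open>\<mu>\<close>,
    since multiplication by \<open>\<epsilon>\<close> gives them the signature required in the lower
    bound for \<open>T\<close>. At each \<open>\<alpha> t\<close> it equals \<open>T l\<close>,
    because \<open>T\<close> kills rational integers.\<close>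
  define U where "U y = T (\<epsilon> * y)" for y
  have \<epsilon>K: "\<epsilon> \<in> K" using O_closed(1) units(1) .
  have U_add: "U (y + z) = U y + U z" if "y \<in> O_K" "z \<in> O_K" for y z
    unfolding U_def distrib_left by (intro T_add K_closed(4) \<epsilon>K O_closed(1)[OF that(1)] O_closed(1)[OF that(2)])
  have U_scale: "U (of_int k * y) = of_int k * U y" if "y \<in> O_K" for y k
    using T_scale[of "\<epsilon> * y" k] that \<epsilon>K by (simp add: U_def mult_ac K_closed O_closed(1))
  have U_\<alpha>: "U (\<alpha> t) \<le> 2 * \<mu>" for t
    unfolding U_def \<epsilon>\<alpha> x_def using T_add[OF O_closed(1)[OF l(1)] int_in_K] T_int l(2)
    by (simp del: of_int_diff)
  have U_pos: "\<mu> \<le> U y" if y: "y \<in> O_K" "totally_positive K y" for y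
    unfolding U_def
  proof (rule \<mu>(2))
    show "\<epsilon> * y \<in> O_K" by (rule O_closed(3)[OF units(1) y(1)])
    have pos: "0 < s j y" if "j \<in> J" for j using y(2) that totally_positive_iff by blast
    have sm: "s j (\<epsilon> * y) = s j \<epsilon> * s j y" if "j \<in> J" for j
      using s_hom(2)[OF that \<epsilon>K O_closed(1)[OF y(1)]] .
    show "s i (\<epsilon> * y) < 0" using sm[OF i] pos[OF i] \<epsilon>(1) by (simp add: mult_less_0_iff)
    show "0 < s j (\<epsilon> * y)" if "j \<in> J - {i}" for j
      using sm[of j] pos[of j] \<epsilon>(2)[OF that] that by simp
  qed
  have form: "quadratic_form_over O_K r a" and posdef: "totally_positive_definite K r a"
    and repr: "\<And>y. y \<in> O_K \<Longrightarrow> totally_positive K y \<Longrightarrow> \<exists>v\<in>{1..r} \<rightarrow> O_K. qf_eval r a v = y"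
    using univ unfolding universal_form_def by auto
  note eval_O = qf_eval_in_O[OF form]
  have eval_pos: "\<mu> \<le> U (qf_eval r a v)" if "v \<in> {1..r} \<rightarrow> O_K" "\<exists>k\<in>{1..r}. v k \<noteq> 0" for v
    using U_pos[OF eval_O[OF that(1)]] posdef that unfolding totally_positive_definite_def by blast
  have eval_nonneg: "0 \<le> U (qf_eval r a v)" if v: "v \<in> {1..r} \<rightarrow> O_K" for v
  proof (cases "\<exists>k\<in>{1..r}. v k \<noteq> 0")
    case True
    then show ?thesis using eval_pos[OF v] \<mu>(1) by simp
  next
    case False
    then have "qf_eval r a v = 0" unfolding qf_eval_def by (intro sum.neutral ballI) auto
    then show ?thesis using T_int[of 0] by (simp add: U_def)
  qed
  have "\<forall>t. \<exists>v. t < N \<longrightarrow> v \<in> {1..r} \<rightarrow> O_K \<and> qf_eval r a v = \<alpha> t"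
    using repr[OF \<alpha>O \<alpha>_pos] by blast
  then obtain v where v: "\<And>t. t < N \<Longrightarrow> v t \<in> {1..r} \<rightarrow> O_K" "\<And>t. t < N \<Longrightarrow> qf_eval r a (v t) = \<alpha> t"
    by metis
  obtain R where R: "finite R" "card R \<le> c"
    and R_reps: "\<forall>y\<in>O_K. \<exists>u\<in>R. \<exists>z\<in>O_K. y = u + (z + z + z)"
    using reps unfolding reps_mod3_def by (elim exE conjE) (rule that; assumption)
  obtain \<rho> where \<rho>: "\<And>y. y \<in> O_K \<Longrightarrow> \<rho> y \<in> R \<and> (\<exists>z\<in>O_K. y = \<rho> y + (z + z + z))"
    using R_reps by metis
  \<comment> \<open>The class of \<open>v t\<close> modulo 3, coordinate by coordinate. The
    restriction to \<open>{1..r}\<close> places it in a finite extensional product, so that classes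
    can be counted.\<close>
  let ?cls = "\<lambda>t. \<lambda>k\<in>{1..r}. \<rho> (v t k)"
  have "?cls ` {..<N} \<subseteq> {1..r} \<rightarrow>\<^sub>E R"
    using \<rho> v(1) by (fastforce simp: PiE_iff Pi_iff)
  then have "card (?cls ` {..<N}) \<le> card ({1..r} \<rightarrow>\<^sub>E R)"
    using R(1) by (intro card_mono finite_PiE) auto
  also have "\<dots> = card R ^ r" by (simp add: card_PiE)
  also have "\<dots> \<le> c ^ r" using R(2) by (rule power_mono) simp
  also have "\<dots> < card {..<N}" using N by simp
  finally have "\<not> inj_on ?cls {..<N}" by (rule pigeonhole)
  then obtain t t' where t: "t < N" "t' < N" "t \<noteq> t'" and eq: "?cls t = ?cls t'"
    unfolding inj_on_def by auto
  have "\<exists>z. k \<in> {1..r} \<longrightarrow> z \<in> O_K \<and> v t k - v t' k = 3 * z" for k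
  proof (cases "k \<in> {1..r}")
    case True
    then have vk: "v t k \<in> O_K" "v t' k \<in> O_K"
      using funcset_mem[OF v(1)] t by blast+
    moreover have "\<rho> (v t k) = \<rho> (v t' k)" using fun_cong[OF eq, of k] True by simp
    ultimately obtain z z' where z: "z \<in> O_K" "z' \<in> O_K"
      "v t k = \<rho> (v t k) + (z + z + z)" "v t' k = \<rho> (v t k) + (z' + z' + z')"
      using \<rho> by metis
    have "y - y' = 3 * (z - z')" if "y = u + (z + z + z)" "y' = u + (z' + z' + z')" for y y' u :: complex
      using that by simp
    from this[OF z(3,4)] have "v t k - v t' k = 3 * (z - z')" .
    then show ?thesis using O_closed(5)[OF z(1,2)] by blast
  qed blast
  then obtain w where w: "\<And>k. k \<in> {1..r} \<Longrightarrow> w k \<in> O_K"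
    and w3: "\<And>k. k \<in> {1..r} \<Longrightarrow> v t k - v t' k = 3 * w k"
    by metis
  have wO: "w \<in> {1..r} \<rightarrow> O_K" using w by blast
  have "\<exists>k\<in>{1..r}. w k \<noteq> 0"
  proof (rule ccontr)
    assume "\<not> ?thesis"
    then have "v t k = v t' k" if "k \<in> {1..r}" for k using w3[OF that] that by simp
    then have "\<alpha> t = \<alpha> t'" using qf_eval_cong v(2) t by metis
    then have "x t = x t'" using \<epsilon>\<alpha> by metis
    then show False using t(3) unfolding x_def by simp
  qed
  then have "\<mu> \<le> U (qf_eval r a w)" by (rule eval_pos[OF wO])
  let ?p = "\<lambda>k. v t k + v t' k" and ?d = "\<lambda>k. v t k - v t' k"
  have pO: "?p \<in> {1..r} \<rightarrow> O_K" and dO: "?d \<in> {1..r} \<rightarrow> O_K"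
    using v(1)[OF t(1)] v(1)[OF t(2)] O_closed(2,5) by (auto simp: Pi_iff)
  have "qf_eval r a ?d = of_int 9 * qf_eval r a w"
    using qf_eval_cong[of r ?d "\<lambda>k. 3 * w k" a] w3 qf_eval_scale[of r a 3 w] by simp
  then have "U (qf_eval r a ?d) = 9 * U (qf_eval r a w)"
    using U_scale[OF eval_O[OF wO], of 9] by simp
  moreover have "qf_eval r a ?p + qf_eval r a ?d = of_int 2 * \<alpha> t + of_int 2 * \<alpha> t'"
    using qf_eval_parallelogram[of r a "v t" "v t'"] v(2) t by simp
  then have "U (qf_eval r a ?p) + U (qf_eval r a ?d) = 2 * U (\<alpha> t) + 2 * U (\<alpha> t')"
    using U_add[OF eval_O[OF pO] eval_O[OF dO]]
      U_add[OF O_closed(3)[OF O_closed(6) \<alpha>O] O_closed(3)[OF O_closed(6) \<alpha>O], of 2 t 2 t'] U_scale[OF \<alpha>O, of 2]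
    by simp
  \<comment> \<open>As the value at the sum is nonnegative, \<open>9 * \<mu>\<close> is at most
    \<open>U\<close> of the value at the difference, hence at most
    \<open>2 * U (\<alpha> t) + 2 * U (\<alpha> t')\<close>, hence at most
    \<open>8 * \<mu>\<close>.\<close>
  ultimately show False
    using eval_nonneg[OF pO] U_\<alpha>[of t] U_\<alpha>[of t'] \<open>\<mu> \<le> U (qf_eval r a w)\<close> \<mu>(1) by linarith
qed

end

section \<open>Fields given by conjugate coordinates\<close>

text \<open>One rational coordinate is split off at the cost of a factor 3. The hypothesis on the
  kernel may assume that it is a subgroup, so the lemma can be applied to the kernel again.\<close>

lemma reps_mod3_step:
  fixes f :: "'a::ab_group_add \<Rightarrow> rat"
  assumes G: "additive_subgroup_set G"
    and f: "\<And>x y. x \<in> G \<Longrightarrow> y \<in> G \<Longrightarrow> f (x - y) = f x - f y"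
    and kernel: "additive_subgroup_set {x\<in>G. f x = 0} \<Longrightarrow> reps_mod3 {x\<in>G. f x = 0} l"
  shows "reps_mod3 G (3 * l)"
proof (rule reps_mod3_exact[OF G f])
  have f0: "f 0 = 0" using f additive_subgroup_setD(1)[OF G] by force
  show "reps_mod3 (f ` G) 3"
  proof (rule reps_mod3_rat)
    show "additive_subgroup_set (f ` G)"
      unfolding additive_subgroup_set_def
    proof (intro conjI ballI)
      show "0 \<in> f ` G" using f0 additive_subgroup_setD(1)[OF G] by (metis imageI)
      fix x y assume "x \<in> f ` G" "y \<in> f ` G"
      then obtain x' y' where *: "x' \<in> G" "y' \<in> G" "x = f x'" "y = f y'" by blast
      then have "x - y = f (x' - y')" by (simp add: f)
      then show "x - y \<in> f ` G" using additive_subgroup_setD(2)[OF G *(1,2)] by blast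
    qed
  qed
  show "reps_mod3 {x\<in>G. f x = 0} l"
    by (rule kernel)
       (use f f0 additive_subgroup_setD(1,2)[OF G] in \<open>auto simp: additive_subgroup_set_def\<close>)
qed

section \<open>Rational structure and degree of subfields of the complex numbers\<close>

lemma additive_rat_eq_of_rat:
  fixes f :: "rat \<Rightarrow> 'a::field_char_0"
  assumes add: "\<And>x y. f (x + y) = f x + f y" and "f 1 = 1"
  shows "f x = of_rat x"
proof -
  have f0: "f 0 = 0" using add[of 0 0] by simp
  have f_minus: "f (- x) = - f x" for x using add[of x "- x"] f0 by (simp add: eq_neg_iff_add_eq_0 add.commute)
  have nat: "f (of_nat n * x) = of_nat n * f x" for n x
    by (induction n) (simp_all add: f0 add distrib_right)
  have int: "f (of_int k * x) = of_int k * f x" for k x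
  proof (cases k rule: int_cases2)
    case (nonneg n)
    then show ?thesis using nat[of n x] by simp
  next
    case (nonpos n)
    then show ?thesis using nat[of n x] f_minus[of "of_nat n * x"] by simp
  qed
  obtain a b where q: "quotient_of x = (a, b)" by (cases "quotient_of x")
  have x: "x = of_int a / of_int b" "b > 0"
    using quotient_of_div[OF q] quotient_of_denom_pos[OF q] by auto
  have "of_int b * f x = f (of_int b * x)" by (simp add: int)
  also have "\<dots> = f (of_int a * 1)" using x by simp
  also have "\<dots> = of_int a" unfolding int \<open>f 1 = 1\<close> by simp
  finally have "f x = of_int a / of_int b" using x(2) by (simp add: field_simps)
  also have "\<dots> = of_rat x" unfolding x(1) by (simp add: of_rat_divide)
  finally show ?thesis .
qed

lemma complex_ring_simps:
  "carrier complex_ring = UNIV" "x \<otimes>\<^bsub>complex_ring\<^esub> y = x * y" "x \<oplus>\<^bsub>complex_ring\<^esub> y = x + y"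
  "\<one>\<^bsub>complex_ring\<^esub> = 1" "\<zero>\<^bsub>complex_ring\<^esub> = 0"
  by (simp_all add: ring_of_type_algebra_def)

lemma subfield_complexI:
  assumes "0 \<in> K" "1 \<in> K" "\<And>x. x \<in> K \<Longrightarrow> - x \<in> K"
    "\<And>x y. x \<in> K \<Longrightarrow> y \<in> K \<Longrightarrow> x + y \<in> K" "\<And>x y. x \<in> K \<Longrightarrow> y \<in> K \<Longrightarrow> x * y \<in> K"
    "\<And>x. x \<in> K \<Longrightarrow> x \<noteq> 0 \<Longrightarrow> inverse x \<in> K"
  shows "subfield K complex_ring"
proof -
  interpret F: field complex_ring by (rule field_from_type_algebra)
  have a_inv: "a_inv complex_ring x = - x" for x
    by (rule F.minus_equality) (auto simp: complex_ring_simps)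
  show ?thesis
  proof (rule F.subfieldI')
    show "subring K complex_ring"
      by (rule F.subringI) (use assms a_inv in \<open>auto simp: complex_ring_simps\<close>)
    fix k assume k: "k \<in> K - {\<zero>\<^bsub>complex_ring\<^esub>}"
    then have "inv\<^bsub>complex_ring\<^esub> k = inverse k"
      by (intro F.comm_inv_char) (auto simp: complex_ring_simps)
    then show "inv\<^bsub>complex_ring\<^esub> k \<in> K" using k assms by (simp add: complex_ring_simps)
  qed
qed

text \<open>Degrees are computed by adjoining the members of a power basis one at a time; this is
  one such line extension.\<close>

lemma dimension_extend:
  assumes "ring.dimension complex_ring n \<rat> E" "v \<notin> E"
  shows "ring.dimension complex_ring (Suc n) \<rat> {x. \<exists>a e. e \<in> E \<and> x = of_rat a * v + e}"
proof -
  interpret R: ring complex_ring by (rule ring_from_type_algebra)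
  have "R.dimension (Suc n) \<rat> (R.line_extension \<rat> v E)"
    using assms by (intro R.Suc_dim) (simp_all add: complex_ring_simps)
  moreover have "R.line_extension \<rat> v E = {x. \<exists>a e. e \<in> E \<and> x = of_rat a * v + e}"
    unfolding set_eq_iff R.line_extension_mem_iff complex_ring_simps Rats_def by blast
  ultimately show ?thesis by simp
qed

lemma dimension_zero_set: "ring.dimension complex_ring 0 \<rat> {0}"
  using ring.zero_dim[OF ring_from_type_algebra[where 'a = complex], of \<rat>] by (simp add: complex_ring_simps)

text \<open>The field is given abstractly by rational coordinates in \<open>'v\<close> with product
  \<open>mul\<close>. The map \<open>ev j\<close> evaluates coordinates at the \<open>j\<close>-th
  conjugate of the generator, and \<open>ev 0\<close> realizes the field inside the reals. By
  \<open>hom_cases\<close> these maps exhaust the complex embeddings.\<close>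

locale conjugate_coordinates =
  fixes ev :: "nat \<Rightarrow> 'v::ab_group_add \<Rightarrow> real" and mul :: "'v \<Rightarrow> 'v \<Rightarrow> 'v" and one :: 'v
    and J :: "nat set"
  assumes finite_J: "finite J" and zero_J: "0 \<in> J"
    and ev_add: "\<And>j u w. j \<in> J \<Longrightarrow> ev j (u + w) = ev j u + ev j w"
    and ev_mul: "\<And>j u w. j \<in> J \<Longrightarrow> ev j (mul u w) = ev j u * ev j w"
    and ev_one: "\<And>j. j \<in> J \<Longrightarrow> ev j one = 1"
    and ev_0_eq_0: "\<And>u. ev 0 u = 0 \<Longrightarrow> u = 0"
    and inverse: "\<And>u. u \<noteq> 0 \<Longrightarrow> \<exists>w. mul u w = one"
    and hom_cases: "\<And>\<tau> :: 'v \<Rightarrow> complex. (\<And>u w. \<tau> (u + w) = \<tau> u + \<tau> w) \<Longrightarrow>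
      (\<And>u w. \<tau> (mul u w) = \<tau> u * \<tau> w) \<Longrightarrow> \<tau> one = 1 \<Longrightarrow>
      \<exists>j\<in>J. \<forall>u. \<tau> u = complex_of_real (ev j u)"
begin

definition K :: "complex set" where "K = range (\<lambda>u. complex_of_real (ev 0 u))"
definition coord :: "complex \<Rightarrow> 'v" where "coord x = (THE u. x = complex_of_real (ev 0 u))"
definition conj :: "nat \<Rightarrow> complex \<Rightarrow> real" where "conj j x = ev j (coord x)"
abbreviation elem :: "'v \<Rightarrow> complex" where "elem u \<equiv> complex_of_real (ev 0 u)"

lemma ev_minus:
  assumes "j \<in> J" shows "ev j 0 = 0" "ev j (- u) = - ev j u" "ev j (u - w) = ev j u - ev j w"
proof -
  show zero: "ev j 0 = 0" using ev_add[OF assms, of 0 0] by simp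
  show minus: "ev j (- u) = - ev j u" for u using ev_add[OF assms, of u "- u"] zero by simp
  show "ev j (u - w) = ev j u - ev j w" using ev_add[OF assms, of u "- w"] minus by simp
qed

lemma elem_inject: "elem u = elem w \<longleftrightarrow> u = w"
  using ev_0_eq_0[of "u - w"] ev_minus(3)[OF zero_J] by auto

lemma coord_elem [simp]: "coord (elem u) = u"
  unfolding coord_def by (rule the_equality) (simp_all add: elem_inject del: of_real_eq_iff)

lemma elem_in_K [simp]: "elem u \<in> K" unfolding K_def by blast

lemma elem_coord: "x \<in> K \<Longrightarrow> elem (coord x) = x"
  unfolding K_def using coord_elem by fastforce

lemma K_cases:
  assumes "x \<in> K" obtains u where "x = elem u"
  using assms unfolding K_def by blast

lemma conj_elem [simp]: "conj j (elem u) = ev j u" by (simp add: conj_def)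

lemma subfield_K: "subfield K complex_ring"
proof (rule subfield_complexI)
  show "0 \<in> K" using elem_in_K[of 0] ev_minus(1)[OF zero_J] by simp
  show "1 \<in> K" using elem_in_K[of one] ev_one[OF zero_J] by simp
  fix x assume "x \<in> K"
  then obtain u where u: "x = elem u" by (rule K_cases)
  show "- x \<in> K" unfolding u using elem_in_K[of "- u"] ev_minus(2)[OF zero_J] by simp
  {
    fix y assume "y \<in> K"
    then obtain w where w: "y = elem w" by (rule K_cases)
    show "x + y \<in> K" unfolding u w using elem_in_K[of "u + w"] ev_add[OF zero_J] by simp
    show "x * y \<in> K" unfolding u w using elem_in_K[of "mul u w"] ev_mul[OF zero_J] by simp
  }
  show "inverse x \<in> K" if "x \<noteq> 0"
  proof -
    have "u \<noteq> 0" using that u ev_minus(1)[OF zero_J] by auto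
    then obtain w where "mul u w = one" using inverse by blast
    then have "ev 0 u * ev 0 w = 1" using ev_mul[OF zero_J, of u w] ev_one[OF zero_J] by simp
    then have "x * elem w = 1" unfolding u by (metis of_real_1 of_real_mult)
    then have "inverse x = elem w" by (rule inverse_unique)
    then show ?thesis by simp
  qed
qed

sublocale real_embeddings K J conj
proof (rule real_embeddings.intro)
  show "subfield K complex_ring" by (rule subfield_K)
  show "finite J" by (rule finite_J)
next
  fix j assume j: "j \<in> J"
  show "(\<lambda>x. complex_of_real (conj j x)) \<in> embeddings K"
    unfolding embeddings_def
  proof (rule ring_hom_memI)
    fix x y assume "x \<in> carrier (field_ring K)" "y \<in> carrier (field_ring K)"
    then obtain u w where u: "x = elem u" and w: "y = elem w" by (auto elim!: K_cases)
    have "x * y = elem (mul u w)" "x + y = elem (u + w)"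
      unfolding u w using ev_mul[OF zero_J] ev_add[OF zero_J] by auto
    then have "conj j (x * y) = conj j x * conj j y" "conj j (x + y) = conj j x + conj j y"
      using u w ev_mul[OF j] ev_add[OF j] by (simp_all del: of_real_add of_real_mult)
    then show "complex_of_real (conj j (x \<otimes>\<^bsub>field_ring K\<^esub> y)) =
        complex_of_real (conj j x) \<otimes>\<^bsub>complex_ring\<^esub> complex_of_real (conj j y)"
      "complex_of_real (conj j (x \<oplus>\<^bsub>field_ring K\<^esub> y)) =
        complex_of_real (conj j x) \<oplus>\<^bsub>complex_ring\<^esub> complex_of_real (conj j y)"
      by (simp_all add: complex_ring_simps)
  next
    have "conj j 1 = 1" using conj_elem[of j one] ev_one[OF j] ev_one[OF zero_J] by simp
    then show "complex_of_real (conj j \<one>\<^bsub>field_ring K\<^esub>) = \<one>\<^bsub>complex_ring\<^esub>"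
      by (simp add: complex_ring_simps)
  qed (simp add: complex_ring_simps)
next
  fix \<tau> assume "\<tau> \<in> embeddings K"
  note h = this[unfolded embeddings_def]
  have "\<tau> (elem (u + w)) = \<tau> (elem u) + \<tau> (elem w)" for u w
    using ring_hom_add[OF h, of "elem u" "elem w"] ev_add[OF zero_J]
    by (simp add: complex_ring_simps)
  moreover have "\<tau> (elem (mul u w)) = \<tau> (elem u) * \<tau> (elem w)" for u w
    using ring_hom_mult[OF h, of "elem u" "elem w"] ev_mul[OF zero_J]
    by (simp add: complex_ring_simps)
  moreover have "\<tau> (elem one) = 1"
    using ring_hom_one[OF h] ev_one[OF zero_J] by (simp add: complex_ring_simps)
  ultimately obtain j where j: "j \<in> J" "\<And>u. \<tau> (elem u) = complex_of_real (ev j u)"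
    using hom_cases[of "\<lambda>u. \<tau> (elem u)"] by blast
  show "\<exists>j\<in>J. \<forall>x\<in>K. \<tau> x = complex_of_real (conj j x)"
    using j by (auto elim!: K_cases)
qed

lemma coord_diff:
  assumes "x \<in> K" "y \<in> K" shows "coord (x - y) = coord x - coord y"
proof -
  have "x - y = elem (coord x - coord y)"
    using assms ev_minus(3)[OF zero_J] by (simp add: elem_coord)
  then show ?thesis by (metis coord_elem)
qed

end

section \<open>Quadratic fields\<close>

lemma algebraic_int_real_closed:
  fixes x y :: real
  assumes "algebraic_int x" "algebraic_int y"
  shows "algebraic_int (x + y)" "algebraic_int (x * y)" "algebraic_int (x - y)"
proof -
  have "algebraic_int (complex_of_real x)" "algebraic_int (complex_of_real y)"
    "algebraic_int (complex_of_real (- y))"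
    using assms by auto
  then have "algebraic_int (complex_of_real (x + y))" "algebraic_int (complex_of_real (x * y))"
    "algebraic_int (complex_of_real (x + - y))"
    unfolding of_real_add of_real_mult by (simp_all add: algebraic_int_add_mult del: of_real_minus)
  then show "algebraic_int (x + y)" "algebraic_int (x * y)" "algebraic_int (x - y)"
    unfolding algebraic_int_of_real_iff by simp_all
qed

lemma of_real_of_rat [simp]: "complex_of_real (of_rat a) = of_rat a"
  by (rule additive_rat_eq_of_rat) (simp_all add: of_rat_add)

text \<open>Well-ordering of the naturals, carried over by the floor. It supplies the irrational
  integer \<open>l\<close> of least \<open>disc\<close>.\<close>

lemma integral_function_has_minimum:
  fixes f :: "'a \<Rightarrow> real"
  assumes "S \<noteq> {}" and "\<And>x. x \<in> S \<Longrightarrow> f x \<in> \<int> \<and> 0 \<le> f x"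
  shows "\<exists>l\<in>S. \<forall>x\<in>S. f l \<le> f x"
proof -
  obtain x0 where "x0 \<in> S" using assms(1) by blast
  then obtain l where l: "l \<in> S" "\<forall>x. x \<in> S \<longrightarrow> nat \<lfloor>f l\<rfloor> \<le> nat \<lfloor>f x\<rfloor>"
    using ex_has_least_nat[of "\<lambda>x. x \<in> S" x0 "\<lambda>x. nat \<lfloor>f x\<rfloor>"] by blast
  have val: "f x = real (nat \<lfloor>f x\<rfloor>)" if "x \<in> S" for x
    using assms(2)[OF that] by (simp add: of_int_floor)
  show ?thesis
  proof (intro bexI ballI)
    fix x assume x: "x \<in> S"
    then have "nat \<lfloor>f l\<rfloor> \<le> nat \<lfloor>f x\<rfloor>" using l(2) by blast
    then show "f l \<le> f x" using val[OF x] val[OF l(1)] by linarith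
  qed (rule l(1))
qed

text \<open>The valuation of \<open>d\<close> at \<open>p\<close> is 1, so that of
  \<open>t^2 * d\<close> is odd, whereas an integer prime to \<open>p\<close> has valuation
  0.\<close>

lemma prime_dvd_rat_square_mult:
  fixes t :: rat and p d m :: int
  assumes "prime p" "p dvd d" "\<not> p\<^sup>2 dvd d" and eq: "t\<^sup>2 * of_int d = of_int m"
  shows "p dvd m"
proof (rule ccontr)
  assume m: "\<not> p dvd m"
  obtain a b where q: "quotient_of t = (a, b)" by (cases "quotient_of t")
  have t: "t = of_int a / of_int b" and b: "b > 0" and cop: "coprime a b"
    using quotient_of_div[OF q] quotient_of_denom_pos[OF q] quotient_of_coprime[OF q] by auto
  have "of_int (a\<^sup>2 * d) = (of_int (m * b\<^sup>2) :: rat)"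
    using eq b unfolding t by (simp add: power_divide field_simps)
  then have eq': "a\<^sup>2 * d = m * b\<^sup>2" unfolding of_int_eq_iff .
  then have "p dvd m * b\<^sup>2" using \<open>p dvd d\<close> by (metis dvd_mult)
  then have pb: "p dvd b"
    using m \<open>prime p\<close> by (meson prime_dvd_mult_iff prime_dvd_power)
  then have "p\<^sup>2 dvd a\<^sup>2 * d" unfolding eq' by (simp add: dvd_mult)
  moreover have "coprime (p\<^sup>2) (a\<^sup>2)"
    using cop pb by (metis coprime_commute coprime_divisors coprime_power_left_iff coprime_power_right_iff dvd_refl)
  ultimately show False using assms(3) by (simp add: coprime_dvd_mult_right_iff)
qed

section \<open>The fields generated by a square root of q^2 + 1\<close>

text \<open>Divisibility of q^2 + 1 by \<open>p\<close> exactly once makes the radicand a nonsquare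
  and forces \<open>p\<close> into the discriminant of every integer.\<close>

locale real_quadratic =
  fixes q p :: int
  assumes p: "prime p" "p dvd q\<^sup>2 + 1" "\<not> p\<^sup>2 dvd q\<^sup>2 + 1"
begin

definition w :: real where "w = sqrt (of_int (q\<^sup>2 + 1))"

fun ev :: "nat \<Rightarrow> rat \<times> rat \<Rightarrow> real" where
  "ev j (a, b) = of_rat a + (if j = 0 then 1 else - 1) * of_rat b * w"

fun mul :: "rat \<times> rat \<Rightarrow> rat \<times> rat \<Rightarrow> rat \<times> rat" where
  "mul (a, b) (a', b') = (a * a' + of_int (q\<^sup>2 + 1) * b * b', a * b' + b * a')"

lemma w_square: "w * w = of_int (q\<^sup>2 + 1)"
  unfolding w_def by (simp add: add_nonneg_pos)

lemma w_bounds: "w > 0" "of_int \<bar>q\<bar> < w"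
proof -
  have "0 < (of_int (q\<^sup>2 + 1) :: real)" by (simp add: add_nonneg_pos)
  then show "w > 0" unfolding w_def by simp
  have "(of_int \<bar>q\<bar> :: real)\<^sup>2 < of_int (q\<^sup>2 + 1)" by simp
  then show "of_int \<bar>q\<bar> < w" unfolding w_def by (rule real_less_rsqrt)
qed

text \<open>A solution with \<open>b\<close> nonzero makes 1 equal to (q^2 + 1) times the square of
  \<open>b / a\<close>, and then \<open>p\<close> would divide 1. So the norm form has no nontrivial
  zero, which yields both the injectivity of \<open>ev 0\<close> and the inverses.\<close>

lemma norm_nonzero:
  assumes "a\<^sup>2 = of_int (q\<^sup>2 + 1) * b\<^sup>2"
  shows "(a :: rat) = 0" "b = 0"
proof -
  show b: "b = 0"
  proof (rule ccontr)
    assume "b \<noteq> 0"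
    have "q\<^sup>2 + 1 \<noteq> 0" by (simp add: add_nonneg_eq_0_iff)
    then have "(of_int (q\<^sup>2 + 1) :: rat) \<noteq> 0" unfolding of_int_eq_0_iff .
    then have "a \<noteq> 0" using assms \<open>b \<noteq> 0\<close> by auto
    have "(b / a)\<^sup>2 * of_int (q\<^sup>2 + 1) = of_int (q\<^sup>2 + 1) * b\<^sup>2 / a\<^sup>2"
      by (simp add: power_divide)
    also have "\<dots> = of_int 1" unfolding assms[symmetric] using \<open>a \<noteq> 0\<close> by simp
    finally have "(b / a)\<^sup>2 * of_int (q\<^sup>2 + 1) = of_int 1" .
    then have "p dvd 1" by (rule prime_dvd_rat_square_mult[OF p])
    then show False using p(1) not_prime_unit by blast
  qed
  show "a = 0" using assms b by simp
qed

lemma zero_pair: "(0 :: rat \<times> rat) = (0, 0)" by (simp add: zero_prod_def)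

sublocale conjugate_coordinates ev mul "(1, 0)" "{0, 1}"
proof
  show "finite {0, 1 :: nat}" "0 \<in> {0, 1 :: nat}" by auto
next
  fix j u v
  show "ev j (u + v) = ev j u + ev j v"
    by (cases u; cases v) (simp add: of_rat_add algebra_simps)
  have "ev j (mul (a, b) (a', b')) = ev j (a, b) * ev j (a', b')" for a b a' b'
  proof -
    have "(of_rat b * w) * (of_rat b' * w) = (of_rat b * of_rat b') * (w * w)"
      by (simp add: mult_ac)
    then show ?thesis
      unfolding w_square by (simp add: of_rat_add of_rat_mult of_rat_power algebra_simps)
  qed
  then show "ev j (mul u v) = ev j u * ev j v" by (cases u; cases v) blast
  show "ev j (1, 0) = 1" by simp
next
  fix u assume u: "ev 0 u = 0"
  obtain a b where ab: "u = (a, b)" by (cases u)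
  have "of_rat a = - (of_rat b * w)" using u ab by simp
  then have "(of_rat a :: real)\<^sup>2 = (of_rat b)\<^sup>2 * (w * w)" by (simp add: power2_eq_square)
  then have "(of_rat (a\<^sup>2) :: real) = of_rat (of_int (q\<^sup>2 + 1) * b\<^sup>2)"
    unfolding w_square by (simp add: of_rat_power of_rat_mult mult.commute of_rat_add)
  then have "a\<^sup>2 = of_int (q\<^sup>2 + 1) * b\<^sup>2" unfolding of_rat_eq_iff .
  then show "u = 0" unfolding ab zero_pair using norm_nonzero by blast
next
  fix u :: "rat \<times> rat" assume u: "u \<noteq> 0"
  obtain a b where ab: "u = (a, b)" by (cases u)
  define n where "n = a\<^sup>2 - of_int (q\<^sup>2 + 1) * b\<^sup>2"
  have "n \<noteq> 0" using norm_nonzero[of a b] u unfolding n_def ab zero_pair by auto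
  \<comment> \<open>The inverse is the conjugate divided by the norm.\<close>
  then have "mul u (a / n, - b / n) = (1, 0)"
    unfolding ab by (simp add: field_simps) (simp add: n_def power2_eq_square algebra_simps)
  then show "\<exists>v. mul u v = (1, 0)" ..
next
  fix \<tau> :: "rat \<times> rat \<Rightarrow> complex"
  assume add: "\<And>u v. \<tau> (u + v) = \<tau> u + \<tau> v" and mult: "\<And>u v. \<tau> (mul u v) = \<tau> u * \<tau> v"
    and one: "\<tau> (1, 0) = 1"
  have rat: "\<tau> (a, 0) = of_rat a" for a
  proof (rule additive_rat_eq_of_rat)
    show "\<tau> (x + y, 0) = \<tau> (x, 0) + \<tau> (y, 0)" for x y using add[of "(x, 0)" "(y, 0)"] by simp
  qed (rule one)
  define z where "z = \<tau> (0, 1)"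
  have \<tau>: "\<tau> (a, b) = of_rat a + of_rat b * z" for a b
    using add[of "(a, 0)" "(0, b)"] mult[of "(b, 0)" "(0, 1)"] rat unfolding z_def by simp
  have "z * z = of_rat (of_int (q\<^sup>2 + 1))"
    using mult[of "(0, 1)" "(0, 1)"] rat unfolding z_def by simp
  also have "\<dots> = complex_of_real (w * w)" unfolding w_square by (simp add: of_rat_add of_rat_power)
  finally have "(z - of_real w) * (z - - of_real w) = 0" by (simp add: algebra_simps)
  then have "z = of_real w \<or> z = - of_real w" by (simp add: eq_neg_iff_add_eq_0)
  then obtain j where "j \<in> {0, 1::nat}" and z: "z = of_real ((if j = 0 then 1 else - 1) * w)"
    by fastforce
  moreover have "\<tau> u = complex_of_real (ev j u)" for u
    by (cases u) (auto simp: \<tau> z)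
  ultimately show "\<exists>j\<in>{0, 1}. \<forall>u. \<tau> u = complex_of_real (ev j u)" by blast
qed

lemma degree: "number_field_of_degree 2 K"
  unfolding number_field_of_degree_def
proof
  show "subfield K complex_ring" by (rule subfield_K)
  let ?Q = "{x. \<exists>a e. e \<in> {0::complex} \<and> x = of_rat a * 1 + e}"
  have elem: "elem (b, a) = of_rat a * of_real w + of_rat b" for a b by simp
  have "ring.dimension complex_ring (Suc 0) \<rat> ?Q"
    by (rule dimension_extend[OF dimension_zero_set]) simp
  moreover have "complex_of_real w \<notin> ?Q"
  proof
    assume "complex_of_real w \<in> ?Q"
    then obtain a where "complex_of_real w = of_rat a" by auto
    then have "elem (0, 1) = elem (a, 0)" by simp
    then show False unfolding elem_inject by simp
  qed
  ultimately have "ring.dimension complex_ring (Suc (Suc 0)) \<rat>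
      {x. \<exists>a e. e \<in> ?Q \<and> x = of_rat a * of_real w + e}"
    by (rule dimension_extend)
  moreover have "x \<in> K \<longleftrightarrow> (\<exists>a e. e \<in> ?Q \<and> x = of_rat a * of_real w + e)" for x
  proof -
    have "x \<in> K \<longleftrightarrow> (\<exists>a b. x = elem (b, a))" unfolding K_def by (auto simp del: ev.simps)
    then show ?thesis unfolding elem by auto
  qed
  then have "{x. \<exists>a e. e \<in> ?Q \<and> x = of_rat a * of_real w + e} = K" by blast
  ultimately show "ring.dimension complex_ring 2 \<rat> K" by (simp only: numeral_2_eq_2)
qed

lemma elem_O: "elem (of_int a, of_int b) \<in> O_K"
proof -
  have "algebraic_int (complex_of_real w)"
    unfolding w_def algebraic_int_of_real_iff by (intro algebraic_int_sqrt algebraic_int_of_int)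
  then have "algebraic_int (of_int a + of_int b * complex_of_real w)"
    by (intro algebraic_int_add_mult algebraic_int_of_int)
  moreover have "elem (of_int a, of_int b) = of_int a + of_int b * complex_of_real w" by simp
  ultimately show ?thesis
    using elem_in_K[of "(of_int a, of_int b)"] by (metis (mono_tags, lifting) mem_Collect_eq ring_of_integers_def)
qed

text \<open>Each of the two rational coordinates contributes a factor 3.\<close>

lemma reps_mod3_O: "reps_mod3 O_K 9"
proof -
  have *: "x \<in> O_K \<Longrightarrow> y \<in> O_K \<Longrightarrow> coord (x - y) = coord x - coord y" for x y
    by (simp add: coord_diff O_closed)
  have "reps_mod3 O_K (3 * (3 * 1))"
  proof (rule reps_mod3_step[where f = "\<lambda>x. fst (coord x)"], rule subgroup_O)
    let ?G = "{x \<in> O_K. fst (coord x) = 0}"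
    assume G: "additive_subgroup_set ?G"
    show "reps_mod3 ?G (3 * 1)"
    proof (rule reps_mod3_step[where f = "\<lambda>x. snd (coord x)"], rule G)
      have "x = 0" if "x \<in> ?G" "snd (coord x) = 0" for x
        using elem_coord[of x] that O_closed(1)[of x] by (cases "coord x") auto
      moreover have "coord 0 = (0, 0)" using coord_elem[of "(0, 0)"] by simp
      ultimately have "{x \<in> ?G. snd (coord x) = 0} = {0}"
        using additive_subgroup_setD(1)[OF G] by auto
      then show "reps_mod3 {x \<in> ?G. snd (coord x) = 0} 1" using reps_mod3_zero by simp
    qed (use * in auto)
  qed (use * in auto)
  then show ?thesis by simp
qed

text \<open>The discriminant of the quadratic polynomial whose roots are the two conjugates of
  \<open>x\<close>.\<close>

definition disc :: "complex \<Rightarrow> real" where "disc x = (conj 0 x - conj 1 x)\<^sup>2"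

text \<open>In coordinates the discriminant is (2b)^2 (q^2 + 1). It is a rational algebraic integer,
  hence an integer, and its valuation at \<open>p\<close> is odd unless it vanishes.\<close>

lemma disc_O:
  assumes "x \<in> O_K"
  shows "\<exists>m. disc x = of_int m \<and> p dvd m"
proof -
  obtain a b where ab: "coord x = (a, b)" by (cases "coord x")
  have "disc x = (2 * of_rat b)\<^sup>2 * (w * w)"
    unfolding disc_def conj_def ab by (simp add: power2_eq_square)
  also have "\<dots> = of_rat ((2 * b)\<^sup>2 * of_int (q\<^sup>2 + 1))"
    unfolding w_square by (simp add: of_rat_mult of_rat_power of_rat_add)
  finally have rat: "disc x = of_rat ((2 * b)\<^sup>2 * of_int (q\<^sup>2 + 1))" .
  have "algebraic_int (disc x)"
    unfolding disc_def power2_eq_square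
    by (intro algebraic_int_real_closed algebraic_int_s assms) auto
  then have "disc x \<in> \<int>" using rat by (intro rational_algebraic_int_is_int) auto
  then obtain m where m: "disc x = of_int m" by (auto elim: Ints_cases)
  then have "of_rat ((2 * b)\<^sup>2 * of_int (q\<^sup>2 + 1)) = (of_rat (of_int m) :: real)" using rat by simp
  then have "(2 * b)\<^sup>2 * of_int (q\<^sup>2 + 1) = of_int m" unfolding of_rat_eq_iff .
  then have "p dvd m" by (rule prime_dvd_rat_square_mult[OF p])
  then show ?thesis using m by blast
qed

lemma disc_ge:
  assumes "x \<in> O_K" "conj 0 x \<noteq> conj 1 x"
  shows "of_int p \<le> disc x"
proof -
  obtain m where m: "disc x = of_int m" "p dvd m" using disc_O[OF assms(1)] by blast
  have "0 < disc x" unfolding disc_def using assms(2) by simp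
  then have "p \<le> m" using m by (intro zdvd_imp_le) auto
  then show ?thesis using m by simp
qed

text \<open>Every positive discriminant of an integer is at least \<open>p\<close>, so the least one
  exceeds \<open>N^2\<close> and the conjugates of a minimal \<open>l\<close> are more than
  \<open>N\<close> apart.\<close>

lemma no_universal_form_if_large:
  assumes N: "9 ^ r < N" "int (N\<^sup>2) < p"
  shows "\<not> universal_form K r a"
proof -
  let ?S = "{x \<in> O_K. conj 0 x \<noteq> conj 1 x}"
  have "conj 0 (elem (0, 1)) \<noteq> conj 1 (elem (0, 1))"
    unfolding conj_elem using w_bounds by simp
  then have "elem (0, 1) \<in> ?S" using elem_O[of 0 1] by (simp del: ev.simps)
  then have "?S \<noteq> {}" by blast
  moreover have "disc x \<in> \<int> \<and> 0 \<le> disc x" if x: "x \<in> ?S" for x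
  proof -
    obtain m where "disc x = of_int m" using disc_O[of x] x by blast
    then show ?thesis unfolding disc_def by (metis Ints_of_int zero_le_power2)
  qed
  ultimately obtain l where l: "l \<in> ?S" "\<And>x. x \<in> ?S \<Longrightarrow> disc l \<le> disc x"
    using integral_function_has_minimum[of ?S disc] by blast
  \<comment> \<open>The sign is chosen so that the conjugate with index 1, where the unit is
    negative, is the smaller one.\<close>
  define l' where "l' = (if conj 1 l < conj 0 l then l else - l)"
  have l': "l' \<in> O_K" using l(1) O_closed(4) by (simp add: l'_def)
  have "conj 0 l' - conj 1 l' = \<bar>conj 0 l - conj 1 l\<bar>"
    using l(1) s_hom(5)[of _ l] O_closed(1)[of l] by (auto simp: l'_def)
  then have gap: "conj 0 l' - conj 1 l' = sqrt (disc l)" by (simp add: disc_def)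
  have disc_l: "real (N\<^sup>2) < disc l"
  proof -
    have "real (N\<^sup>2) < of_int p" using N(2) by linarith
    also have "\<dots> \<le> disc l" using disc_ge l(1) by blast
    finally show ?thesis .
  qed
  then have pos: "0 < disc l" by (meson le_less_trans of_nat_0_le_iff)
  show ?thesis
  \<comment> \<open>The unit is q + w, with inverse w - q because w^2 - q^2 = 1; its other conjugate
    q - w is negative. Here \<open>T x\<close> is just \<open>conj 0 x - conj 1 x\<close>, the
    square root of \<open>disc x\<close> up to sign.\<close>
  proof (rule no_universal_form[where i = 1 and \<epsilon> = "elem (of_int q, of_int 1)"
        and \<delta> = "elem (of_int (- q), of_int 1)" and l = l' and \<mu> = "sqrt (disc l)" and c = 9 and N = N and T = "\<lambda>x. \<Sum>j\<in>{0, 1}. conj j x - conj 1 x"])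
    show "elem (of_int q, of_int 1) * elem (of_int (- q), of_int 1) = 1"
    proof -
      have "ev 0 (of_int q, of_int 1) * ev 0 (of_int (- q), of_int 1) = w * w - (of_int q)\<^sup>2"
        by (simp add: algebra_simps power2_eq_square of_rat_minus)
      also have "\<dots> = 1" unfolding w_square by simp
      finally show ?thesis by (metis of_real_1 of_real_mult)
    qed
    show "conj 1 (elem (of_int q, of_int 1)) < 0"
      unfolding conj_elem using w_bounds by simp
    show "0 < conj j (elem (of_int q, of_int 1))" if "j \<in> {0, 1} - {1}" for j
      using that w_bounds unfolding conj_elem by auto
    show "(\<Sum>j\<in>{0, 1}. conj j l' - conj 1 l') \<le> 2 * sqrt (disc l)"
      using gap pos by simp
    show "real N < conj j l' - conj 1 l'" if "j \<in> {0, 1} - {1}" for j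
    proof -
      have "real N < sqrt (disc l)" using disc_l by (intro real_less_rsqrt) simp
      then show ?thesis using gap that by auto
    qed
    show "sqrt (disc l) \<le> (\<Sum>j\<in>{0, 1}. conj j x - conj 1 x)"
      if x: "x \<in> O_K" "conj 1 x < 0" "\<And>j. j \<in> {0, 1} - {1} \<Longrightarrow> 0 < conj j x" for x
    proof -
      have "0 < conj 0 x" using x(3)[of 0] by simp
      then have "conj 0 x \<noteq> conj 1 x" using x(2) by linarith
      then have "disc l \<le> disc x" using x(1) l(2) by blast
      then have "sqrt (disc l) \<le> \<bar>conj 0 x - conj 1 x\<bar>" unfolding disc_def[of x]
        using real_sqrt_le_mono by fastforce
      then show ?thesis using \<open>0 < conj 0 x\<close> x(2) by simp
    qed
    show "elem (of_int q, of_int 1) \<in> O_K" "elem (of_int (- q), of_int 1) \<in> O_K" by (rule elem_O)+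
  qed (use l' reps_mod3_O N pos in auto)
qed

text \<open>A square root of k^2 + 1 is an irrational integer whose conjugates have square k^2 + 1,
  so its discriminant is at most 4(k^2 + 1) but at least \<open>p\<close>. This limits which small
  \<open>k\<close> can occur in the field.\<close>

lemma root_bound:
  fixes k :: nat
  assumes x: "x \<in> K" "x\<^sup>2 = of_nat (k\<^sup>2 + 1)" and k: "k > 0"
  shows "p \<le> 4 * ((int k)\<^sup>2 + 1)"
proof -
  have "algebraic_int x"
  proof (rule algebraic_int_root[of "of_nat (k\<^sup>2 + 1)" "monom 1 2" x])
    show "poly (monom 1 2) x = of_nat (k\<^sup>2 + 1)" using x(2) by (simp add: poly_monom)
    show "\<forall>i. Polynomial.coeff (monom (1 :: complex) 2) i \<in> \<int>" by simp
    show "algebraic_int (of_nat (k\<^sup>2 + 1) :: complex)" by (rule algebraic_int_of_nat)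
  qed (simp_all add: degree_monom_eq)
  then have xO: "x \<in> O_K" using x(1) by (simp add: ring_of_integers_def)
  have conj_sq: "(conj j x)\<^sup>2 = of_nat (k\<^sup>2 + 1)" if "j \<in> {0, 1}" for j
  proof -
    have "conj j (of_int (int (k\<^sup>2 + 1))) = of_int (int (k\<^sup>2 + 1))" by (rule s_of_int[OF that])
    then have "conj j (x * x) = of_nat (k\<^sup>2 + 1)" using x(2) by (simp add: power2_eq_square)
    then show ?thesis using s_hom(2)[OF that x(1) x(1)] by (simp add: power2_eq_square)
  qed
  have "conj 0 x \<noteq> conj 1 x"
  proof
    assume eq: "conj 0 x = conj 1 x"
    obtain a b where ab: "coord x = (a, b)" by (cases "coord x")
    have "b = 0" using eq w_bounds(1) unfolding conj_def ab by simp
    then have "conj 0 x \<in> \<rat>" unfolding conj_def ab by simp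
    moreover have "algebraic_int (conj 0 x)" using algebraic_int_s xO by simp
    ultimately have "conj 0 x \<in> \<int>" using rational_algebraic_int_is_int by blast
    then obtain m where "conj 0 x = of_int m" by (auto elim: Ints_cases)
    then have "(of_int (m\<^sup>2) :: real) = of_int (int (k\<^sup>2 + 1))" using conj_sq[of 0] by simp
    then have m: "\<bar>m\<bar>\<^sup>2 = (int k)\<^sup>2 + 1" unfolding of_int_eq_iff by simp
    \<comment> \<open>For positive \<open>k\<close> the number k^2 + 1 lies strictly between the
      consecutive squares k^2 and (k + 1)^2.\<close>
    show False
    proof (cases "\<bar>m\<bar> \<le> int k")
      case True
      then have "\<bar>m\<bar>\<^sup>2 \<le> (int k)\<^sup>2" by (intro power_mono) auto
      then show False using m by simp
    next
      case False
      then have "(int k + 1)\<^sup>2 \<le> \<bar>m\<bar>\<^sup>2" by (intro power_mono) auto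
      then show False using m k by (simp add: power2_eq_square algebra_simps)
    qed
  qed
  then have "of_int p \<le> disc x" by (rule disc_ge[OF xO])
  also have "disc x \<le> 2 * (conj 0 x)\<^sup>2 + 2 * (conj 1 x)\<^sup>2"
    unfolding disc_def using zero_le_power2[of "conj 0 x + conj 1 x"]
    by (simp add: power2_eq_square algebra_simps)
  also have "\<dots> = of_int (4 * ((int k)\<^sup>2 + 1))" using conj_sq by simp
  finally show ?thesis unfolding of_int_le_iff .
qed

end

section \<open>Simplest cubic fields\<close>

text \<open>The norm of a + b x + c x^2 in the cubic algebra defined by x^3 = P x + R.\<close>

definition cubic_norm :: "'a::comm_ring_1 \<Rightarrow> 'a \<Rightarrow> 'a \<Rightarrow> 'a \<Rightarrow> 'a \<Rightarrow> 'a" where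
  "cubic_norm P R a b c = a ^ 3 + 2 * P * a\<^sup>2 * c + P\<^sup>2 * a * c\<^sup>2 - P * a * b\<^sup>2
     - 3 * R * a * b * c + R * b ^ 3 + R\<^sup>2 * c ^ 3 - P * R * b * c\<^sup>2"

text \<open>The coordinates are treated in turn: modulo p only a^3 survives in the norm; once p
  divides a, only R b^3 survives modulo p^2; once p divides b as well, only R^2 c^3 survives modulo
  p^3.\<close>

lemma eisenstein_norm_dvd:
  fixes p P R a b c :: int
  assumes p: "prime p" and "p dvd P" "p dvd R" "\<not> p\<^sup>2 dvd R"
    and norm: "p ^ 3 dvd cubic_norm P R a b c"
  shows "p dvd a" "p dvd b" "p dvd c"
proof -
  obtain P' where P: "P = p * P'" using \<open>p dvd P\<close> by blast
  obtain R' where R: "R = p * R'" using \<open>p dvd R\<close> by blast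
  have "\<not> p dvd R'" using \<open>\<not> p\<^sup>2 dvd R\<close> unfolding R power2_eq_square by auto
  obtain n where n: "cubic_norm P R a b c = p ^ 3 * n" using norm by blast
  have "p \<noteq> 0" using p by auto
  have "a ^ 3 = p * (p\<^sup>2 * n - (2 * P' * a\<^sup>2 * c + p * P'\<^sup>2 * a * c\<^sup>2 - P' * a * b\<^sup>2
     - 3 * R' * a * b * c + R' * b ^ 3 + p * R'\<^sup>2 * c ^ 3 - p * P' * R' * b * c\<^sup>2))"
    using n unfolding cubic_norm_def P R by (simp add: algebra_simps power2_eq_square power3_eq_cube)
  then show "p dvd a" using p by (metis dvd_triv_left prime_dvd_power)
  then obtain a' where a: "a = p * a'" by blast
  have "p * (R' * b ^ 3) = p * (p * (p * n - (p * a' ^ 3 + 2 * p * P' * a'\<^sup>2 * c + p * P'\<^sup>2 * a' * c\<^sup>2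
     - P' * a' * b\<^sup>2 - 3 * R' * a' * b * c + R'\<^sup>2 * c ^ 3 - P' * R' * b * c\<^sup>2)))"
    using n unfolding cubic_norm_def P R a by (simp add: algebra_simps power2_eq_square power3_eq_cube)
  then have "p dvd R' * b ^ 3" using \<open>p \<noteq> 0\<close> by (metis dvd_triv_left mult_left_cancel)
  then show "p dvd b" using p \<open>\<not> p dvd R'\<close> by (meson prime_dvd_mult_iff prime_dvd_power)
  then obtain b' where b: "b = p * b'" by blast
  have "p\<^sup>2 * (R'\<^sup>2 * c ^ 3) = p\<^sup>2 * (p * (n - (a' ^ 3 + 2 * P' * a'\<^sup>2 * c + P'\<^sup>2 * a' * c\<^sup>2
     - p * P' * a' * b'\<^sup>2 - 3 * R' * a' * b' * c + p * R' * b' ^ 3 - P' * R' * b' * c\<^sup>2)))"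
    using n unfolding cubic_norm_def P R a b by (simp add: algebra_simps power2_eq_square power3_eq_cube)
  then have "p dvd R'\<^sup>2 * c ^ 3" using \<open>p \<noteq> 0\<close> by (metis dvd_triv_left mult_left_cancel power_not_zero)
  then show "p dvd c" using p \<open>\<not> p dvd R'\<close> by (meson prime_dvd_mult_iff prime_dvd_power)
qed

text \<open>Infinite descent: a zero is divisible by \<open>p\<close> in all coordinates, and the
  quotient is a smaller zero.\<close>

lemma eisenstein_norm_eq_0:
  fixes p P R a b c :: int
  assumes p: "prime p" "p dvd P" "p dvd R" "\<not> p\<^sup>2 dvd R"
    and norm: "cubic_norm P R a b c = 0"
  shows "a = 0 \<and> b = 0 \<and> c = 0"
  using norm
proof (induction "nat (\<bar>a\<bar> + \<bar>b\<bar> + \<bar>c\<bar>)" arbitrary: a b c rule: less_induct)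
  case less
  have "p ^ 3 dvd cubic_norm P R a b c" using less.prems by simp
  note dvd = eisenstein_norm_dvd[OF p this]
  obtain a' b' c' where abc: "a = p * a'" "b = p * b'" "c = p * c'" using dvd by (meson dvdE)
  have "p > 1" using p(1) prime_gt_1_int by blast
  have "p ^ 3 * cubic_norm P R a' b' c' = cubic_norm P R a b c"
    unfolding abc cubic_norm_def by (simp add: algebra_simps power2_eq_square power3_eq_cube)
  then have zero: "cubic_norm P R a' b' c' = 0" using less.prems \<open>p > 1\<close> by simp
  have shrink: "\<bar>x\<bar> \<le> \<bar>p * x\<bar>" "x \<noteq> 0 \<Longrightarrow> \<bar>x\<bar> < \<bar>p * x\<bar>" for x
    using \<open>p > 1\<close> mult_right_mono[of 1 p "\<bar>x\<bar>"] mult_strict_right_mono[of 1 p "\<bar>x\<bar>"] by (auto simp: abs_mult)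
  show ?case
  proof (rule ccontr)
    assume nonzero: "\<not> ?thesis"
    then have "\<bar>a'\<bar> + \<bar>b'\<bar> + \<bar>c'\<bar> < \<bar>a\<bar> + \<bar>b\<bar> + \<bar>c\<bar>"
      using shrink[of a'] shrink[of b'] shrink[of c'] unfolding abc by auto
    then have "a' = 0 \<and> b' = 0 \<and> c' = 0" using less.hyps[OF _ zero] by linarith
    then show False using nonzero abc by simp
  qed
qed

text \<open>Take the least positive common denominator; if \<open>p\<close> divided it and all
  numerators, cancelling \<open>p\<close> would give a smaller one. This primitivity at
  \<open>p\<close> is what shows that denominators of integers are prime to
  \<open>p\<close>.\<close>

lemma common_denominator:
  fixes a b c :: rat and p :: int
  assumes "p > 1"
  obtains e a' b' c' :: int where "e > 0" "of_int e * a = of_int a'" "of_int e * b = of_int b'"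
    "of_int e * c = of_int c'" "\<not> (p dvd e \<and> p dvd a' \<and> p dvd b' \<and> p dvd c')"
proof -
  define D where "D e \<longleftrightarrow> e > 0 \<and> (\<exists>a' b' c'. of_int (int e) * a = of_int a' \<and>
    of_int (int e) * b = of_int b' \<and> of_int (int e) * c = of_int c')" for e :: nat
  obtain a1 a2 where a: "quotient_of a = (a1, a2)" by (cases "quotient_of a")
  obtain b1 b2 where b: "quotient_of b = (b1, b2)" by (cases "quotient_of b")
  obtain c1 c2 where c: "quotient_of c = (c1, c2)" by (cases "quotient_of c")
  note div = quotient_of_div[OF a] quotient_of_div[OF b] quotient_of_div[OF c]
  note pos = quotient_of_denom_pos[OF a] quotient_of_denom_pos[OF b] quotient_of_denom_pos[OF c]
  have "of_int (a2 * b2 * c2) * a = of_int (a1 * b2 * c2)"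
    "of_int (a2 * b2 * c2) * b = of_int (a2 * b1 * c2)"
    "of_int (a2 * b2 * c2) * c = of_int (a2 * b2 * c1)"
    using pos unfolding div by simp_all
  moreover have "a2 * b2 * c2 = int (nat (a2 * b2 * c2))" "nat (a2 * b2 * c2) > 0" using pos by simp_all
  ultimately have "D (nat (a2 * b2 * c2))" unfolding D_def by metis
  then obtain e where e: "D e" "\<And>k. k < e \<Longrightarrow> \<not> D k" using exists_least_iff[of D] by blast
  then obtain a' b' c' where abc: "of_int (int e) * a = of_int a'" "of_int (int e) * b = of_int b'"
    "of_int (int e) * c = of_int c'" and "e > 0" unfolding D_def by blast
  have "\<not> (p dvd int e \<and> p dvd a' \<and> p dvd b' \<and> p dvd c')"
  proof
    assume "p dvd int e \<and> p dvd a' \<and> p dvd b' \<and> p dvd c'"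
    then obtain k a'' b'' c'' where *: "int e = p * k" "a' = p * a''" "b' = p * b''" "c' = p * c''"
      by (meson dvdE)
    have "0 < p * k" using *(1) \<open>e > 0\<close> by linarith
    then have "k > 0" using \<open>p > 1\<close> by (simp add: zero_less_mult_iff)
    have "of_int k * a = of_int a''" "of_int k * b = of_int b''" "of_int k * c = of_int c''"
      using abc \<open>p > 1\<close> unfolding * by simp_all
    then have "D (nat k)" unfolding D_def using \<open>k > 0\<close> by auto
    moreover have "nat k < e"
      using *(1) \<open>k > 0\<close> \<open>p > 1\<close> mult_strict_right_mono[of 1 p k] by linarith
    ultimately show False using e(2) by blast
  qed
  then show thesis using that[of "int e" a' b' c'] abc \<open>e > 0\<close> by simp
qed

text \<open>For sorted values with consecutive gaps g and h, \<open>d\<close> is g^2 + g h + h^2, at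
  most three times the square of the larger gap. That gap isolates the smallest value or the largest
  one.\<close>

lemma largest_gap:
  fixes c :: "nat \<Rightarrow> real"
  defines "d \<equiv> (c 0)\<^sup>2 + (c 1)\<^sup>2 + (c 2)\<^sup>2 - c 0 * c 1 - c 0 * c 2 - c 1 * c 2"
  shows "\<exists>i\<in>{0, 1, 2}. (\<forall>j\<in>{0, 1, 2} - {i}. sqrt (d / 3) \<le> c j - c i) \<or>
    (\<forall>j\<in>{0, 1, 2} - {i}. sqrt (d / 3) \<le> c i - c j)"
proof -
  have gap: "sqrt ((x\<^sup>2 + y\<^sup>2 + z\<^sup>2 - x * y - x * z - y * z) / 3) \<le> max (y - x) (z - y)"
    if "x \<le> y" "y \<le> z" for x y z :: real
  proof -
    define g where "g = max (y - x) (z - y)"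
    have le: "y - x \<le> g" "z - y \<le> g" "0 \<le> y - x" "0 \<le> z - y" using that unfolding g_def by auto
    have "x\<^sup>2 + y\<^sup>2 + z\<^sup>2 - x * y - x * z - y * z = (y - x) * (y - x) + (y - x) * (z - y) + (z - y) * (z - y)"
      by (simp add: algebra_simps power2_eq_square)
    also have "\<dots> \<le> g * g + g * g + g * g" using le by (intro add_mono mult_mono) auto
    finally have "(x\<^sup>2 + y\<^sup>2 + z\<^sup>2 - x * y - x * z - y * z) / 3 \<le> g\<^sup>2" by (simp add: power2_eq_square)
    then have "sqrt ((x\<^sup>2 + y\<^sup>2 + z\<^sup>2 - x * y - x * z - y * z) / 3) \<le> \<bar>g\<bar>"
      unfolding real_sqrt_abs[symmetric] by (rule real_sqrt_le_mono)
    then show ?thesis using le unfolding g_def by linarith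
  qed
  have sorted: "?thesis" if ord: "c i \<le> c j" "c j \<le> c k" and ijk: "{i, j, k} = {0, 1, 2}"
    and sym: "(c i)\<^sup>2 + (c j)\<^sup>2 + (c k)\<^sup>2 - c i * c j - c i * c k - c j * c k = d" for i j k
  proof -
    have "sqrt (d / 3) \<le> c j - c i \<or> sqrt (d / 3) \<le> c k - c j"
      using gap[OF ord] unfolding sym by (simp add: le_max_iff_disj)
    then show ?thesis
    proof
      assume "sqrt (d / 3) \<le> c j - c i"
      then have "\<forall>l\<in>{i, j, k} - {i}. sqrt (d / 3) \<le> c l - c i" using ord by auto
      then show ?thesis using ijk by (metis insertI1)
    next
      assume "sqrt (d / 3) \<le> c k - c j"
      then have "\<forall>l\<in>{i, j, k} - {k}. sqrt (d / 3) \<le> c k - c l" using ord by auto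
      then show ?thesis using ijk by (metis insertI1 insertI2)
    qed
  qed
  consider "c 0 \<le> c 1" "c 1 \<le> c 2" | "c 0 \<le> c 2" "c 2 \<le> c 1" | "c 1 \<le> c 0" "c 0 \<le> c 2"
    | "c 1 \<le> c 2" "c 2 \<le> c 0" | "c 2 \<le> c 0" "c 0 \<le> c 1" | "c 2 \<le> c 1" "c 1 \<le> c 0"
    by linarith
  then show ?thesis
  proof cases
    case 1 then show ?thesis by (rule sorted) (auto simp: d_def)
  next
    case 2 then show ?thesis by (rule sorted) (auto simp: d_def)
  next
    case 3 then show ?thesis by (rule sorted) (auto simp: d_def)
  next
    case 4 then show ?thesis by (rule sorted) (auto simp: d_def)
  next
    case 5 then show ?thesis by (rule sorted) (auto simp: d_def)
  next
    case 6 then show ?thesis by (rule sorted) (auto simp: d_def)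
  qed
qed

section \<open>The simplest cubic fields and their embeddings\<close>

text \<open>The sign conditions number the three roots, so that the signatures of
  \<open>\<rho>\<close> and \<open>\<rho> + 1\<close> are known.\<close>

locale simplest_cubic =
  fixes a p :: int and \<rho> :: "nat \<Rightarrow> real"
  assumes p: "prime p" "3 < p" "p dvd a\<^sup>2 + 3 * a + 9" "\<not> p\<^sup>2 dvd a\<^sup>2 + 3 * a + 9"
    and root: "\<And>j. j \<in> {0, 1, 2} \<Longrightarrow> \<rho> j ^ 3 = of_int a * (\<rho> j)\<^sup>2 + of_int (a + 3) * \<rho> j + 1"
    and signs: "\<rho> 0 < - 1" "- 1 < \<rho> 1" "\<rho> 1 < 0" "0 < \<rho> 2"
begin

text \<open>\<open>\<theta> = 3 \<rho> - a\<close> is a root of \<open>x\<^sup>3 - P x - R\<close>, which has no quadratic term and is Eisenstein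
  at \<open>p\<close>.\<close>

definition P :: int where "P = 3 * (a\<^sup>2 + 3 * a + 9)"
definition R :: int where "R = (2 * a + 3) * (a\<^sup>2 + 3 * a + 9)"
definition \<theta> :: "nat \<Rightarrow> real" where "\<theta> j = 3 * \<rho> j - of_int a"

text \<open>The factor 2a + 3 of \<open>R\<close> is prime to \<open>p\<close>, because 4(a^2 + 3a +
  9) - (2a + 3)^2 = 27 and \<open>p\<close> exceeds 3.\<close>

lemma eisenstein: "p dvd P" "p dvd R" "\<not> p\<^sup>2 dvd R"
proof -
  show "p dvd P" "p dvd R" unfolding P_def R_def using p(3) by (rule dvd_mult)+
  have "\<not> p dvd 2 * a + 3"
  proof
    assume "p dvd 2 * a + 3"
    then have "p dvd (2 * a + 3)\<^sup>2" by (simp add: power2_eq_square)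
    moreover have "p dvd 4 * (a\<^sup>2 + 3 * a + 9)" using p(3) by (rule dvd_mult)
    ultimately have "p dvd 4 * (a\<^sup>2 + 3 * a + 9) - (2 * a + 3)\<^sup>2" by (rule dvd_diff[rotated])
    also have "4 * (a\<^sup>2 + 3 * a + 9) - (2 * a + 3)\<^sup>2 = 3 ^ 3" by (simp add: power2_eq_square algebra_simps)
    finally have "p dvd 3" using p(1) prime_dvd_power by blast
    then show False using p(2) zdvd_imp_le by fastforce
  qed
  then have "coprime (p\<^sup>2) (2 * a + 3)" using p(1) by (simp add: prime_imp_coprime)
  then show "\<not> p\<^sup>2 dvd R" unfolding R_def using p(4) by (simp add: coprime_dvd_mult_right_iff)
qed

lemma \<theta>_cube: "j \<in> {0, 1, 2} \<Longrightarrow> \<theta> j ^ 3 = of_int P * \<theta> j + of_int R"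
  using root[of j] unfolding \<theta>_def P_def R_def
  by (simp add: algebra_simps power2_eq_square power3_eq_cube)

text \<open>Vieta's relations, from subtracting the equations of distinct roots. Expressing
  everything through \<open>\<theta> 0\<close> and \<open>\<theta> 1\<close> turns later symmetric
  identities into polynomial identities in two variables.\<close>

lemma \<theta>_sums:
  shows "\<theta> 2 = - \<theta> 0 - \<theta> 1" "of_int P = (\<theta> 0)\<^sup>2 + \<theta> 0 * \<theta> 1 + (\<theta> 1)\<^sup>2"
    "of_int R = - (\<theta> 0 * \<theta> 1 * (\<theta> 0 + \<theta> 1))"
proof -
  have diff: "x\<^sup>2 + x * y + y\<^sup>2 = of_int P"
    if "x ^ 3 = of_int P * x + of_int R" "y ^ 3 = of_int P * y + of_int R" "x \<noteq> y" for x y :: real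
  proof -
    have "(x - y) * (x\<^sup>2 + x * y + y\<^sup>2 - of_int P) = (x ^ 3 - of_int P * x) - (y ^ 3 - of_int P * y)"
      by (simp add: algebra_simps power2_eq_square power3_eq_cube)
    also have "\<dots> = 0" using that by simp
    finally show ?thesis using that(3) by simp
  qed
  have ne: "\<theta> 0 \<noteq> \<theta> 1" "\<theta> 0 \<noteq> \<theta> 2" "\<theta> 1 \<noteq> \<theta> 2" using signs unfolding \<theta>_def by auto
  have e1: "(\<theta> 0)\<^sup>2 + \<theta> 0 * \<theta> 1 + (\<theta> 1)\<^sup>2 = of_int P" using \<theta>_cube ne by (intro diff) auto
  have e2: "(\<theta> 0)\<^sup>2 + \<theta> 0 * \<theta> 2 + (\<theta> 2)\<^sup>2 = of_int P" using \<theta>_cube ne by (intro diff) auto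
  have "(\<theta> 1 - \<theta> 2) * (\<theta> 0 + \<theta> 1 + \<theta> 2) = 0"
    using e1 e2 by (simp add: algebra_simps power2_eq_square)
  then show "\<theta> 2 = - \<theta> 0 - \<theta> 1" using ne by simp
  show "of_int P = (\<theta> 0)\<^sup>2 + \<theta> 0 * \<theta> 1 + (\<theta> 1)\<^sup>2" using e1 by simp
  show "of_int R = - (\<theta> 0 * \<theta> 1 * (\<theta> 0 + \<theta> 1))"
    using \<theta>_cube[of 0] unfolding e1[symmetric] by (simp add: algebra_simps power2_eq_square power3_eq_cube)
qed

fun ev :: "nat \<Rightarrow> rat \<times> rat \<times> rat \<Rightarrow> real" where
  "ev j (x, y, z) = of_rat x + of_rat y * \<theta> j + of_rat z * (\<theta> j)\<^sup>2"

text \<open>The product in the basis 1, \<open>\<theta>\<close>, \<open>\<theta>^2\<close>, reduced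
  by \<theta>^3 = P \<theta> + R and \<theta>^4 = P \<theta>^2 + R \<theta>.\<close>

fun mul :: "rat \<times> rat \<times> rat \<Rightarrow> rat \<times> rat \<times> rat \<Rightarrow> rat \<times> rat \<times> rat" where
  "mul (x, y, z) (x', y', z') =
     (x * x' + of_int R * (y * z' + z * y'),
      x * y' + y * x' + of_int P * (y * z' + z * y') + of_int R * z * z',
      x * z' + y * y' + z * x' + of_int P * z * z')"

abbreviation nrm :: "rat \<Rightarrow> rat \<Rightarrow> rat \<Rightarrow> rat" where
  "nrm \<equiv> cubic_norm (of_int P) (of_int R)"

lemma nrm_denominator:
  assumes "of_int e * x = of_int x'" "of_int e * y = of_int y'" "of_int e * z = of_int z'"
  shows "of_int e ^ 3 * nrm x y z = of_int (cubic_norm P R x' y' z')"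
proof -
  have "of_int e ^ 3 * nrm x y z = nrm (of_int e * x) (of_int e * y) (of_int e * z)"
    unfolding cubic_norm_def by (simp add: algebra_simps power2_eq_square power3_eq_cube)
  then show ?thesis unfolding assms by (simp add: cubic_norm_def)
qed

lemma nrm_eq_0:
  assumes "nrm x y z = 0" shows "x = 0 \<and> y = 0 \<and> z = 0"
proof -
  obtain e x' y' z' where e: "e > 0" "of_int e * x = of_int x'" "of_int e * y = of_int y'"
    "of_int e * z = of_int z'"
    by (rule common_denominator[of p x y z]) (use p(2) in auto)
  have "cubic_norm P R x' y' z' = 0"
    using nrm_denominator[OF e(2-4)] assms by simp
  then have "x' = 0 \<and> y' = 0 \<and> z' = 0" by (rule eisenstein_norm_eq_0[OF p(1) eisenstein])
  then show ?thesis using e by simp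
qed

lemma ev_prod: "ev 0 (x, y, z) * ev 1 (x, y, z) * ev 2 (x, y, z) = of_rat (nrm x y z)"
proof -
  have "(x + y * s + z * s\<^sup>2) * (x + y * t + z * t\<^sup>2) * (x + y * (- s - t) + z * (- s - t)\<^sup>2)
    = cubic_norm (s\<^sup>2 + s * t + t\<^sup>2) (- (s * t * (s + t))) x y z" for x y z s t :: real
    unfolding cubic_norm_def by (simp add: algebra_simps power2_eq_square power3_eq_cube)
  then have "ev 0 (x, y, z) * ev 1 (x, y, z) * ev 2 (x, y, z) =
      cubic_norm (of_int P) (of_int R) (of_rat x) (of_rat y) (of_rat z)"
    unfolding ev.simps \<theta>_sums by blast
  also have "\<dots> = of_rat (nrm x y z)"
    unfolding cubic_norm_def by (simp add: of_rat_add of_rat_diff of_rat_mult of_rat_power)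
  finally show ?thesis .
qed

lemma zero_triple: "(0 :: rat \<times> rat \<times> rat) = (0, 0, 0)" by (simp add: zero_prod_def)

sublocale conjugate_coordinates ev mul "(1, 0, 0)" "{0, 1, 2}"
proof
  show "finite {0, 1, 2 :: nat}" "0 \<in> {0, 1, 2 :: nat}" by auto
next
  fix j and u v :: "rat \<times> rat \<times> rat" assume j: "j \<in> {0, 1, 2 :: nat}"
  obtain x y z where u: "u = (x, y, z)" by (cases u)
  obtain x' y' z' where v: "v = (x', y', z')" by (cases v)
  show "ev j (u + v) = ev j u + ev j v"
    unfolding u v by (simp add: of_rat_add algebra_simps)
  have prod: "(x + y * t + z * t\<^sup>2) * (x' + y' * t + z' * t\<^sup>2) =
      x * x' + (x * y' + y * x') * t + (x * z' + y * y' + z * x') * t\<^sup>2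
        + (y * z' + z * y') * t ^ 3 + z * z' * (t * t ^ 3)" for x y z x' y' z' t :: real
    by (simp add: algebra_simps power2_eq_square power3_eq_cube)
  show "ev j (mul u v) = ev j u * ev j v"
    unfolding u v ev.simps mul.simps prod \<theta>_cube[OF j]
    by (simp add: of_rat_add of_rat_mult algebra_simps power2_eq_square)
  show "ev j (1, 0, 0) = 1" by simp
next
  fix u assume "ev 0 u = 0"
  moreover obtain x y z where u: "u = (x, y, z)" by (cases u)
  ultimately have "of_rat (nrm x y z) = (0 :: real)"
    using ev_prod[of x y z] by simp
  then have "nrm x y z = 0" by simp
  then show "u = 0" unfolding u zero_triple using nrm_eq_0 by blast
next
  fix u :: "rat \<times> rat \<times> rat" assume "u \<noteq> 0"
  moreover obtain x y z where u: "u = (x, y, z)" by (cases u)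
  ultimately have n: "nrm x y z \<noteq> 0" using nrm_eq_0[of x y z] unfolding zero_triple by auto
  define n where "n = nrm x y z"
  \<comment> \<open>cofactors of the matrix of multiplication by \<open>u\<close>\<close>
  define x' where "x' = (x + of_int P * z)\<^sup>2 - of_int P * y\<^sup>2 - of_int R * y * z"
  define y' where "y' = of_int R * z\<^sup>2 - x * y"
  define z' where "z' = y\<^sup>2 - x * z - of_int P * z\<^sup>2"
  have adj: "x * x' + of_int R * (y * z' + z * y') = n"
    "x * y' + y * x' + of_int P * (y * z' + z * y') + of_int R * z * z' = 0"
    "x * z' + y * y' + z * x' + of_int P * z * z' = 0"
    unfolding n_def cubic_norm_def x'_def y'_def z'_def
    by (simp_all add: algebra_simps power2_eq_square power3_eq_cube)
  have scale: "mul u (x' / n, y' / n, z' / n) = ((x * x' + of_int R * (y * z' + z * y')) / n,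
      (x * y' + y * x' + of_int P * (y * z' + z * y') + of_int R * z * z') / n,
      (x * z' + y * y' + z * x' + of_int P * z * z') / n)"
    unfolding u by (simp add: add_divide_distrib algebra_simps)
  have "mul u (x' / n, y' / n, z' / n) = (1, 0, 0)"
    unfolding scale adj using n by (simp add: n_def)
  then show "\<exists>v. mul u v = (1, 0, 0)" ..
next
  fix \<tau> :: "rat \<times> rat \<times> rat \<Rightarrow> complex"
  assume add: "\<And>u v. \<tau> (u + v) = \<tau> u + \<tau> v" and mult: "\<And>u v. \<tau> (mul u v) = \<tau> u * \<tau> v"
    and one: "\<tau> (1, 0, 0) = 1"
  have rat: "\<tau> (x, 0, 0) = of_rat x" for x
  proof (rule additive_rat_eq_of_rat)
    show "\<tau> (x + y, 0, 0) = \<tau> (x, 0, 0) + \<tau> (y, 0, 0)" for x y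
      using add[of "(x, 0, 0)" "(y, 0, 0)"] by simp
  qed (rule one)
  define t where "t = \<tau> (0, 1, 0)"
  have t2: "\<tau> (0, 0, 1) = t\<^sup>2"
    using mult[of "(0, 1, 0)" "(0, 1, 0)"] unfolding t_def by (simp add: power2_eq_square)
  have \<tau>: "\<tau> (x, y, z) = of_rat x + of_rat y * t + of_rat z * t\<^sup>2" for x y z
    using add[of "(x, 0, 0)" "(0, y, z)"] add[of "(0, y, 0)" "(0, 0, z)"]
      mult[of "(y, 0, 0)" "(0, 1, 0)"] mult[of "(z, 0, 0)" "(0, 0, 1)"] rat t2
    unfolding t_def by simp
  have "t * t\<^sup>2 = of_int R + of_int P * t"
    using mult[of "(0, 1, 0)" "(0, 0, 1)"] \<tau>[of "of_int R" "of_int P" 0] t2 unfolding t_def by simp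
  moreover have "of_int P = complex_of_real (of_int P)" "of_int R = complex_of_real (of_int R)"
    by simp_all
  ultimately have cube: "t * t\<^sup>2 = complex_of_real (of_int R) + complex_of_real (of_int P) * t" by metis
  have "(t - of_real (\<theta> 0)) * (t - of_real (\<theta> 1)) * (t - of_real (\<theta> 2)) =
      t * t\<^sup>2 - complex_of_real (of_int P) * t - complex_of_real (of_int R)"
    unfolding \<theta>_sums by (simp add: algebra_simps power2_eq_square)
  also have "\<dots> = 0" unfolding cube by simp
  finally have "\<exists>j\<in>{0, 1, 2}. t = of_real (\<theta> j)" by auto
  then obtain j where j: "j \<in> {0, 1, 2}" and t: "t = of_real (\<theta> j)" by blast
  have "\<tau> u = complex_of_real (ev j u)" for u
    by (cases u) (auto simp: \<tau> t)
  then show "\<exists>j\<in>{0, 1, 2}. \<forall>u. \<tau> u = complex_of_real (ev j u)" using j by blast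
qed

lemma degree: "number_field_of_degree 3 K"
  unfolding number_field_of_degree_def
proof
  show "subfield K complex_ring" by (rule subfield_K)
  define t where "t = complex_of_real (\<theta> 0)"
  have elem: "elem (x, y, z) = of_rat z * t\<^sup>2 + (of_rat y * t + of_rat x)" for x y z
    by (simp add: t_def)
  let ?Q = "{x. \<exists>a e. e \<in> {0::complex} \<and> x = of_rat a * 1 + e}"
  let ?L = "{x. \<exists>a e. e \<in> ?Q \<and> x = of_rat a * t + e}"
  have Q: "e \<in> ?Q \<longleftrightarrow> (\<exists>x. e = of_rat x)" for e by auto
  have L: "e \<in> ?L \<longleftrightarrow> (\<exists>x y. e = of_rat y * t + of_rat x)" for e by auto
  have "ring.dimension complex_ring (Suc 0) \<rat> ?Q"
    by (rule dimension_extend[OF dimension_zero_set]) simp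
  moreover have "t \<notin> ?Q"
  proof
    assume "t \<in> ?Q"
    then obtain x where "t = of_rat x" unfolding Q by blast
    then have "elem (0, 1, 0) = elem (x, 0, 0)" unfolding elem by simp
    then show False unfolding elem_inject by simp
  qed
  ultimately have "ring.dimension complex_ring (Suc (Suc 0)) \<rat> ?L"
    by (rule dimension_extend)
  moreover have "t\<^sup>2 \<notin> ?L"
  proof
    assume "t\<^sup>2 \<in> ?L"
    then obtain x y where "t\<^sup>2 = of_rat y * t + of_rat x" unfolding L by blast
    then have "elem (0, 0, 1) = elem (x, y, 0)" unfolding elem by simp
    then show False unfolding elem_inject by simp
  qed
  ultimately have "ring.dimension complex_ring (Suc (Suc (Suc 0))) \<rat>
      {x. \<exists>a e. e \<in> ?L \<and> x = of_rat a * t\<^sup>2 + e}"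
    by (rule dimension_extend)
  moreover have "w \<in> K \<longleftrightarrow> (\<exists>a e. e \<in> ?L \<and> w = of_rat a * t\<^sup>2 + e)" for w
  proof -
    have "w \<in> K \<longleftrightarrow> (\<exists>x y z. w = elem (x, y, z))" unfolding K_def by (auto simp del: ev.simps)
    then show ?thesis unfolding elem L by blast
  qed
  then have "{x. \<exists>a e. e \<in> ?L \<and> x = of_rat a * t\<^sup>2 + e} = K" by blast
  ultimately show "ring.dimension complex_ring 3 \<rat> K" by (simp only: numeral_3_eq_3)
qed

lemma reps_mod3_O: "reps_mod3 O_K 27"
proof -
  have *: "x \<in> O_K \<Longrightarrow> y \<in> O_K \<Longrightarrow> coord (x - y) = coord x - coord y" for x y
    by (simp add: coord_diff O_closed)
  have "reps_mod3 O_K (3 * (3 * (3 * 1)))"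
  proof (rule reps_mod3_step[where f = "\<lambda>x. fst (coord x)"], rule subgroup_O)
    let ?G = "{x \<in> O_K. fst (coord x) = 0}"
    assume G: "additive_subgroup_set ?G"
    show "reps_mod3 ?G (3 * (3 * 1))"
    proof (rule reps_mod3_step[where f = "\<lambda>x. fst (snd (coord x))"], rule G)
      let ?H = "{x \<in> ?G. fst (snd (coord x)) = 0}"
      assume H: "additive_subgroup_set ?H"
      show "reps_mod3 ?H (3 * 1)"
      proof (rule reps_mod3_step[where f = "\<lambda>x. snd (snd (coord x))"], rule H)
        have "x = 0" if "x \<in> ?H" "snd (snd (coord x)) = 0" for x
          using elem_coord[of x] that O_closed(1)[of x] by (cases "coord x") auto
        moreover have "coord 0 = (0, 0, 0)" using coord_elem[of "(0, 0, 0)"] by simp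
        ultimately have "{x \<in> ?H. snd (snd (coord x)) = 0} = {0}"
          using additive_subgroup_setD(1)[OF H] by auto
        then show "reps_mod3 {x \<in> ?H. snd (snd (coord x)) = 0} 1" using reps_mod3_zero by simp
      qed (use * in auto)
    qed (use * in auto)
  qed (use * in auto)
  then show ?thesis by simp
qed

section \<open>The gap form on cubic integers, units, and the nonexistence result\<close>

text \<open>Half the sum of the squared differences of the conjugates. Being quadratic in
  \<open>x\<close>, it is not the discriminant of the cubic polynomial of \<open>x\<close>.\<close>

definition disc :: "complex \<Rightarrow> real" where
  "disc x = (conj 0 x)\<^sup>2 + (conj 1 x)\<^sup>2 + (conj 2 x)\<^sup>2
     - conj 0 x * conj 1 x - conj 0 x * conj 2 x - conj 1 x * conj 2 x"

lemma disc_coord: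
  assumes "coord x = (u, v, w)"
  shows "disc x = of_rat (3 * of_int P * v\<^sup>2 + 9 * of_int R * v * w + (of_int P)\<^sup>2 * w\<^sup>2)"
proof -
  have "(u + v * s + w * s\<^sup>2)\<^sup>2 + (u + v * t + w * t\<^sup>2)\<^sup>2 + (u + v * (- s - t) + w * (- s - t)\<^sup>2)\<^sup>2
      - (u + v * s + w * s\<^sup>2) * (u + v * t + w * t\<^sup>2)
      - (u + v * s + w * s\<^sup>2) * (u + v * (- s - t) + w * (- s - t)\<^sup>2)
      - (u + v * t + w * t\<^sup>2) * (u + v * (- s - t) + w * (- s - t)\<^sup>2)
    = 3 * (s\<^sup>2 + s * t + t\<^sup>2) * v\<^sup>2 + 9 * (- (s * t * (s + t))) * v * w
        + (s\<^sup>2 + s * t + t\<^sup>2)\<^sup>2 * w\<^sup>2" for u v w s t :: real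
    by (simp add: algebra_simps power2_eq_square)
  then have "disc x = 3 * of_int P * (of_rat v)\<^sup>2 + 9 * of_int R * of_rat v * of_rat w
      + (of_int P)\<^sup>2 * (of_rat w)\<^sup>2"
    unfolding disc_def conj_def assms ev.simps \<theta>_sums by blast
  then show ?thesis by (simp add: of_rat_add of_rat_mult of_rat_power)
qed

text \<open>The value and the norm of \<open>x\<close> are rational algebraic integers, hence
  integers. If \<open>p\<close> divided the least common denominator \<open>e\<close> of the
  coordinates, \<open>p ^ 3\<close> would divide the norm of the numerators, so \<open>p\<close>
  would divide them all. Hence \<open>e\<close> is prime to \<open>p\<close>, and \<open>p\<close>
  divides \<open>e^2 * m\<close> through \<open>P\<close> and \<open>R\<close>.\<close>

lemma disc_O:
  assumes "x \<in> O_K"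
  shows "\<exists>m. disc x = of_int m \<and> p dvd m"
proof -
  obtain u v w where c: "coord x = (u, v, w)" by (cases "coord x")
  have alg: "algebraic_int (conj j x)" if "j \<in> {0, 1, 2}" for j
    using algebraic_int_s[OF that assms] .
  have "algebraic_int (disc x)"
    unfolding disc_def power2_eq_square by (intro algebraic_int_real_closed alg) auto
  then have "disc x \<in> \<int>" using disc_coord[OF c] by (intro rational_algebraic_int_is_int) auto
  then obtain m where m: "disc x = of_int m" by (auto elim: Ints_cases)
  have "conj 0 x * conj 1 x * conj 2 x = of_rat (nrm u v w)"
    unfolding conj_def c by (rule ev_prod)
  moreover have "algebraic_int (conj 0 x * conj 1 x * conj 2 x)"
    by (intro algebraic_int_real_closed alg) auto
  ultimately have "conj 0 x * conj 1 x * conj 2 x \<in> \<int>"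
    by (intro rational_algebraic_int_is_int) auto
  then obtain n where "of_rat (nrm u v w) = (of_int n :: real)"
    using \<open>conj 0 x * conj 1 x * conj 2 x = _\<close> by (auto elim: Ints_cases)
  then have "of_rat (nrm u v w) = (of_rat (of_int n) :: real)" by simp
  then have n: "nrm u v w = of_int n" unfolding of_rat_eq_iff .
  have "p > 1" using p(2) by simp
  then obtain e u' v' w' where e: "e > 0" "of_int e * u = of_int u'" "of_int e * v = of_int v'"
    "of_int e * w = of_int w'" and min: "\<not> (p dvd e \<and> p dvd u' \<and> p dvd v' \<and> p dvd w')"
    by (rule common_denominator)
  have "of_int (cubic_norm P R u' v' w') = (of_int (e ^ 3 * n) :: rat)"
    using nrm_denominator[OF e(2-4)] n by simp
  then have norm: "cubic_norm P R u' v' w' = e ^ 3 * n" unfolding of_int_eq_iff .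
  have "\<not> p dvd e"
  proof
    assume "p dvd e"
    then have "p ^ 3 dvd cubic_norm P R u' v' w'" unfolding norm by (simp add: dvd_power_same)
    then show False using eisenstein_norm_dvd[OF p(1) eisenstein] min \<open>p dvd e\<close> by blast
  qed
  have "of_rat (of_int m) = (of_rat (3 * of_int P * v\<^sup>2 + 9 * of_int R * v * w + (of_int P)\<^sup>2 * w\<^sup>2) :: real)"
    using m disc_coord[OF c] by simp
  then have "of_int m = 3 * of_int P * v\<^sup>2 + 9 * of_int R * v * w + (of_int P)\<^sup>2 * w\<^sup>2"
    unfolding of_rat_eq_iff .
  then have "of_int (e\<^sup>2 * m) = 3 * of_int P * (of_int e * v)\<^sup>2 + 9 * of_int R * (of_int e * v) * (of_int e * w)
      + (of_int P)\<^sup>2 * (of_int e * w)\<^sup>2"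
    by (simp add: algebra_simps power2_eq_square)
  also have "\<dots> = of_int (3 * P * v'\<^sup>2 + 9 * R * v' * w' + P\<^sup>2 * w'\<^sup>2)"
    unfolding e by simp
  finally have "e\<^sup>2 * m = 3 * P * v'\<^sup>2 + 9 * R * v' * w' + P\<^sup>2 * w'\<^sup>2" unfolding of_int_eq_iff .
  also have "p dvd \<dots>" using eisenstein(1,2) by (simp add: power2_eq_square)
  finally have "p dvd m" using p(1) \<open>\<not> p dvd e\<close> by (meson prime_dvd_mult_iff prime_dvd_power)
  then show ?thesis using m by blast
qed

lemma disc_eq: "disc x = ((conj 0 x - conj 1 x)\<^sup>2 + (conj 0 x - conj 2 x)\<^sup>2 + (conj 1 x - conj 2 x)\<^sup>2) / 2"
  unfolding disc_def by (simp add: algebra_simps power2_eq_square)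

lemma disc_nonneg: "0 \<le> disc x"
  unfolding disc_eq by simp

lemma disc_eq_0: "disc x = 0 \<longleftrightarrow> conj 0 x = conj 1 x \<and> conj 0 x = conj 2 x"
  unfolding disc_eq by (auto simp: add_nonneg_eq_0_iff)

lemma disc_ge:
  assumes "x \<in> O_K" "disc x \<noteq> 0"
  shows "of_int p \<le> disc x"
proof -
  obtain m where m: "disc x = of_int m" "p dvd m" using disc_O[OF assms(1)] by blast
  then have "p \<le> m" using disc_nonneg[of x] assms(2) by (intro zdvd_imp_le) auto
  then show ?thesis using m by simp
qed

text \<open>The root \<open>\<rho> 0\<close> as an element of the field, by \<rho> = (\<theta> + a)
  / 3.\<close>

definition r0 :: complex where "r0 = elem (of_int a / 3, 1 / 3, 0)"

lemma conj_r0: "conj j r0 = \<rho> j"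
proof -
  have "conj j r0 = ev j (of_int a / 3, 1 / 3, 0)" unfolding r0_def by (rule conj_elem)
  also have "\<dots> = \<rho> j" by (simp add: \<theta>_def of_rat_divide field_simps)
  finally show ?thesis .
qed

lemma r0_eq: "r0 = complex_of_real (\<rho> 0)"
  using conj_r0[of 0] unfolding r0_def conj_elem by simp

lemma r0_root: "r0 ^ 3 = of_int a * r0\<^sup>2 + of_int (a + 3) * r0 + 1"
proof -
  have "complex_of_real (\<rho> 0 ^ 3) = complex_of_real (of_int a * (\<rho> 0)\<^sup>2 + of_int (a + 3) * \<rho> 0 + 1)"
    using root[of 0] by simp
  then show ?thesis unfolding r0_eq by simp
qed

lemma algebraic_int_cubic_root:
  assumes "x ^ 3 = of_int b * x\<^sup>2 + of_int c * x + (1 :: complex)"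
  shows "algebraic_int x"
proof (rule algebraic_int.intros)
  let ?f = "[:- 1, - of_int c, - of_int b, 1:] :: complex poly"
  show "lead_coeff ?f = 1" by simp
  show "\<forall>i. Polynomial.coeff ?f i \<in> \<int>"
    by (auto simp: coeff_pCons split: nat.splits)
  show "poly ?f x = 0" using assms by (simp add: algebra_simps power2_eq_square power3_eq_cube)
qed

lemma r0_O: "r0 \<in> O_K"
  unfolding ring_of_integers_def
  using algebraic_int_cubic_root[OF r0_root] elem_in_K[of "(of_int a / 3, 1 / 3, 0)"]
  unfolding r0_def by blast

text \<open>By the position of the roots, \<rho> + 1, \<rho>(\<rho> + 1) and -\<rho> are negative
  exactly at the embeddings 0, 1 and 2 respectively.\<close>

lemma unit_exists:
  assumes "i \<in> {0, 1, 2}"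
  shows "\<exists>\<epsilon>\<in>O_K. \<exists>\<delta>\<in>O_K. \<epsilon> * \<delta> = 1 \<and> conj i \<epsilon> < 0 \<and> (\<forall>j\<in>{0, 1, 2} - {i}. 0 < conj j \<epsilon>)"
proof -
  note O_int = O_closed(6)
  have one: "1 \<in> O_K" using O_int[of 1] by simp
  \<comment> \<open>The defining cubic has constant term -1 and takes the value 1 at -1; dividing it
    by x and by x + 1 yields the inverses \<open>g\<close> of \<open>r0\<close> and \<open>h\<close>
    of \<open>r0 + 1\<close>.\<close>
  define g where "g = r0\<^sup>2 - of_int a * r0 - of_int (a + 3)"
  define h where "h = of_int 2 - r0\<^sup>2 + of_int (a + 1) * r0"
  have g: "g \<in> O_K" and h: "h \<in> O_K"
    unfolding g_def h_def power2_eq_square by (intro O_closed(2,3,5) O_int r0_O)+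
  have rg: "r0 * g = 1"
    using r0_root unfolding g_def by (simp add: algebra_simps power2_eq_square power3_eq_cube)
  have rh: "(r0 + 1) * h = 1"
    using r0_root unfolding h_def by (simp add: algebra_simps power2_eq_square power3_eq_cube)
  have r1: "r0 + 1 \<in> O_K" by (rule O_closed(2)[OF r0_O one])
  have c1: "conj j (r0 + 1) = \<rho> j + 1" if "j \<in> {0, 1, 2}" for j
    using s_hom(1,3)[OF that] O_closed(1) r0_O one by (simp add: conj_r0)
  have c2: "conj j (r0 * (r0 + 1)) = \<rho> j * (\<rho> j + 1)" if "j \<in> {0, 1, 2}" for j
    using s_hom(2)[OF that O_closed(1)[OF r0_O] O_closed(1)[OF r1]] c1[OF that] by (simp add: conj_r0)
  have c3: "conj j (- r0) = - \<rho> j" if "j \<in> {0, 1, 2}" for j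
    using s_hom(5)[OF that O_closed(1)[OF r0_O]] by (simp add: conj_r0)
  consider "i = 0" | "i = 1" | "i = 2" using assms by auto
  then show ?thesis
  proof cases
    case 1
    have "conj 0 (r0 + 1) < 0" "0 < conj 1 (r0 + 1)" "0 < conj 2 (r0 + 1)"
      using c1[of 0] c1[of 1] c1[of 2] signs by auto
    then have "conj i (r0 + 1) < 0 \<and> (\<forall>j\<in>{0, 1, 2} - {i}. 0 < conj j (r0 + 1))" unfolding 1 by blast
    then show ?thesis using r1 h rh by blast
  next
    case 2
    have "0 < \<rho> 0 * (\<rho> 0 + 1)" using signs by (intro mult_neg_neg) auto
    moreover have "\<rho> 1 * (\<rho> 1 + 1) < 0" using signs by (intro mult_neg_pos) auto
    moreover have "0 < \<rho> 2 * (\<rho> 2 + 1)" using signs by (intro mult_pos_pos) auto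
    ultimately have "0 < conj 0 (r0 * (r0 + 1))" "conj 1 (r0 * (r0 + 1)) < 0" "0 < conj 2 (r0 * (r0 + 1))"
      using c2[of 0] c2[of 1] c2[of 2] by auto
    then have "conj i (r0 * (r0 + 1)) < 0 \<and> (\<forall>j\<in>{0, 1, 2} - {i}. 0 < conj j (r0 * (r0 + 1)))"
      unfolding 2 by blast
    moreover have "(r0 * (r0 + 1)) * (g * h) = (r0 * g) * ((r0 + 1) * h)" by (simp only: mult_ac)
    then have "(r0 * (r0 + 1)) * (g * h) = 1" unfolding rg rh by simp
    ultimately show ?thesis using O_closed(3)[OF r0_O r1] O_closed(3)[OF g h] by blast
  next
    case 3
    have "0 < conj 0 (- r0)" "0 < conj 1 (- r0)" "conj 2 (- r0) < 0"
      using c3[of 0] c3[of 1] c3[of 2] signs by auto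
    then have "conj i (- r0) < 0 \<and> (\<forall>j\<in>{0, 1, 2} - {i}. 0 < conj j (- r0))" unfolding 3 by blast
    moreover have "(- r0) * (- g) = 1" using rg by simp
    ultimately show ?thesis using O_closed(4)[OF r0_O] O_closed(4)[OF g] by blast
  qed
qed

text \<open>Let y and z be the differences of the other conjugates to the \<open>i\<close>-th one.
  Then T = y + z and disc = y^2 - y z + z^2, so 4 disc - T^2 = 3(y - z)^2, and T^2 - disc = 3 y z is
  positive if y and z are.\<close>

lemma trace_bounds:
  assumes "i \<in> {0, 1, 2}"
  defines "T \<equiv> \<lambda>x. \<Sum>j\<in>{0, 1, 2}. conj j x - conj i x"
  shows "T x \<le> 2 * sqrt (disc x)"
    "(\<And>j. j \<in> {0, 1, 2} - {i} \<Longrightarrow> conj i x < conj j x) \<Longrightarrow> sqrt (disc x) \<le> T x"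
proof -
  have "\<exists>y z. T x = y + z \<and> disc x = y\<^sup>2 - y * z + z\<^sup>2 \<and>
      ((\<forall>j\<in>{0, 1, 2} - {i}. conj i x < conj j x) \<longrightarrow> 0 < y \<and> 0 < z)"
  proof -
    consider "i = 0" | "i = 1" | "i = 2" using assms by auto
    then show ?thesis
    proof cases
      case 1
      show ?thesis unfolding 1 T_def disc_def
        by (rule exI[of _ "conj 1 x - conj 0 x"], rule exI[of _ "conj 2 x - conj 0 x"])
           (auto simp: algebra_simps power2_eq_square)
    next
      case 2
      show ?thesis unfolding 2 T_def disc_def
        by (rule exI[of _ "conj 0 x - conj 1 x"], rule exI[of _ "conj 2 x - conj 1 x"])
           (auto simp: algebra_simps power2_eq_square)
    next
      case 3
      show ?thesis unfolding 3 T_def disc_def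
        by (rule exI[of _ "conj 0 x - conj 2 x"], rule exI[of _ "conj 1 x - conj 2 x"])
           (auto simp: algebra_simps power2_eq_square)
    qed
  qed
  then obtain y z where yz: "T x = y + z" "disc x = y\<^sup>2 - y * z + z\<^sup>2"
    "(\<forall>j\<in>{0, 1, 2} - {i}. conj i x < conj j x) \<longrightarrow> 0 < y \<and> 0 < z"
    by blast
  have "(y + z)\<^sup>2 \<le> (y + z)\<^sup>2 + 3 * (y - z)\<^sup>2" by simp
  also have "\<dots> = 4 * disc x" unfolding yz(2) by (simp add: algebra_simps power2_eq_square)
  finally have "y + z \<le> sqrt (4 * disc x)" by (rule real_le_rsqrt)
  then show "T x \<le> 2 * sqrt (disc x)" unfolding yz(1) by (simp add: real_sqrt_mult)
  assume "\<And>j. j \<in> {0, 1, 2} - {i} \<Longrightarrow> conj i x < conj j x"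
  then have pos: "0 < y" "0 < z" using yz(3) by blast+
  have "disc x \<le> disc x + 3 * (y * z)" using pos by simp
  also have "\<dots> = (y + z)\<^sup>2" unfolding yz(2) by (simp add: algebra_simps power2_eq_square)
  finally have "sqrt (disc x) \<le> \<bar>y + z\<bar>" unfolding real_sqrt_abs[symmetric] by (rule real_sqrt_le_mono)
  then show "sqrt (disc x) \<le> T x" unfolding yz(1) using pos by simp
qed

text \<open>A minimal \<open>l\<close> has \<open>disc l\<close> at least \<open>p\<close>, so a gap
  larger than \<open>N\<close> isolates one conjugate; changing the sign of \<open>l\<close> if
  necessary makes it the smallest. Its index \<open>i\<close> depends on \<open>l\<close>, which is
  why units of all three signatures are provided.\<close>

lemma no_universal_form_if_large:
  assumes N: "27 ^ r < N" "3 * int (N\<^sup>2) < p"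
  shows "\<not> universal_form K r form"
proof -
  let ?S = "{x \<in> O_K. disc x \<noteq> 0}"
  have "disc r0 \<noteq> 0" unfolding disc_eq_0 conj_r0 using signs by simp
  then have "?S \<noteq> {}" using r0_O by blast
  moreover have "disc x \<in> \<int> \<and> 0 \<le> disc x" if x: "x \<in> ?S" for x
  proof -
    obtain m where "disc x = of_int m" using disc_O[of x] x by blast
    then show ?thesis using disc_nonneg[of x] by simp
  qed
  ultimately obtain l where l: "l \<in> ?S" "\<And>x. x \<in> ?S \<Longrightarrow> disc l \<le> disc x"
    using integral_function_has_minimum[of ?S disc] by blast
  define gap where "gap = sqrt (disc l / 3)"
  have large: "3 * real (N\<^sup>2) < disc l"
  proof -
    have "3 * real (N\<^sup>2) < of_int p" using N(2) by linarith
    also have "\<dots> \<le> disc l" using disc_ge l(1) by blast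
    finally show ?thesis .
  qed
  have pos: "0 < disc l" using l(1) disc_nonneg[of l] by simp
  have N_gap: "real N < gap" unfolding gap_def using large by (intro real_less_rsqrt) simp
  have neg: "conj j (- l) = - conj j l" if "j \<in> {0, 1, 2}" for j
    using s_hom(5)[OF that] l(1) O_closed(1) by blast
  then have disc_neg: "disc (- l) = disc l" by (simp add: disc_def)
  obtain i where i: "i \<in> {0, 1, 2}" and
    "(\<forall>j\<in>{0, 1, 2} - {i}. gap \<le> conj j l - conj i l) \<or> (\<forall>j\<in>{0, 1, 2} - {i}. gap \<le> conj i l - conj j l)"
    using largest_gap[of "\<lambda>j. conj j l"] unfolding gap_def disc_def by blast
  then have "\<exists>l'\<in>O_K. disc l' = disc l \<and> (\<forall>j\<in>{0, 1, 2} - {i}. gap \<le> conj j l' - conj i l')"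
  proof (elim disjE)
    assume "\<forall>j\<in>{0, 1, 2} - {i}. gap \<le> conj j l - conj i l"
    then show ?thesis using l(1) by blast
  next
    assume *: "\<forall>j\<in>{0, 1, 2} - {i}. gap \<le> conj i l - conj j l"
    have "gap \<le> conj j (- l) - conj i (- l)" if "j \<in> {0, 1, 2} - {i}" for j
      using bspec[OF * that] neg[OF i] neg[of j] that by simp
    moreover have "- l \<in> O_K" using l(1) O_closed(4) by blast
    ultimately show ?thesis using disc_neg by blast
  qed
  then obtain l' where l': "l' \<in> O_K" "disc l' = disc l"
    "\<And>j. j \<in> {0, 1, 2} - {i} \<Longrightarrow> gap \<le> conj j l' - conj i l'"
    by blast
  obtain \<epsilon> \<delta> where \<epsilon>: "\<epsilon> \<in> O_K" "\<delta> \<in> O_K" "\<epsilon> * \<delta> = 1" "conj i \<epsilon> < 0"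
    "\<And>j. j \<in> {0, 1, 2} - {i} \<Longrightarrow> 0 < conj j \<epsilon>"
    using unit_exists[OF i] by blast
  show ?thesis
  proof (rule no_universal_form[OF i \<epsilon> refl l'(1), where \<mu> = "sqrt (disc l)" and c = 27 and N = N])
    show "(\<Sum>j\<in>{0, 1, 2}. conj j l' - conj i l') \<le> 2 * sqrt (disc l)"
      using trace_bounds(1)[OF i, of l'] unfolding l'(2) .
    show "real N < conj j l' - conj i l'" if "j \<in> {0, 1, 2} - {i}" for j
      using l'(3)[OF that] N_gap by linarith
    show "sqrt (disc l) \<le> (\<Sum>j\<in>{0, 1, 2}. conj j x - conj i x)"
      if x: "x \<in> O_K" "conj i x < 0" "\<And>j. j \<in> {0, 1, 2} - {i} \<Longrightarrow> 0 < conj j x" for x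
    proof -
      have less: "conj i x < conj j x" if "j \<in> {0, 1, 2} - {i}" for j
        using x(2) x(3)[OF that] by linarith
      define j :: nat where "j = (if i = 0 then 1 else 0)"
      have j: "j \<in> {0, 1, 2} - {i}" by (simp add: j_def)
      have "disc x \<noteq> 0" using less[OF j] i j unfolding disc_eq_0 by auto
      then have "sqrt (disc l) \<le> sqrt (disc x)" using l(2) x(1) by simp
      also have "\<dots> \<le> (\<Sum>j\<in>{0, 1, 2}. conj j x - conj i x)" by (rule trace_bounds(2)[OF i less])
      finally show ?thesis .
    qed
  qed (use reps_mod3_O N pos in auto)
qed

text \<open>All conjugates of \<open>x\<close> are roots of the cubic with parameter
  \<open>k\<close>, so they are smaller than k + 4 in absolute value. Each squared difference is at
  most 4(k + 4)^2, and half the sum of three of them is at least \<open>p\<close>.\<close>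

lemma root_bound:
  fixes k :: nat
  assumes x: "x \<in> K" "x ^ 3 = of_nat k * x\<^sup>2 + of_nat (k + 3) * x + 1"
  shows "p \<le> 6 * (int k + 4)\<^sup>2"
proof -
  have "x ^ 3 = of_int (int k) * x\<^sup>2 + of_int (int (k + 3)) * x + 1" using x(2) by simp
  then have "algebraic_int x" by (rule algebraic_int_cubic_root)
  then have xO: "x \<in> O_K" using x(1) by (simp add: ring_of_integers_def)
  have conj_root: "conj j x ^ 3 = of_nat k * (conj j x)\<^sup>2 + of_nat (k + 3) * conj j x + 1"
    if j: "j \<in> {0, 1, 2}" for j
  proof -
    have "of_int (int k) * (x * x) + of_int (int (k + 3)) * x + 1 = x * (x * x)"
      using x(2) by (simp add: power2_eq_square power3_eq_cube mult.assoc)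
    then have "conj j (of_int (int k) * (x * x) + of_int (int (k + 3)) * x + 1) = conj j (x * (x * x))"
      by simp
    then show ?thesis
      using s_hom(1-3)[OF j] s_of_int[OF j] int_in_K K_closed x(1)
      by (simp add: power2_eq_square power3_eq_cube del: of_int_of_nat_eq of_nat_add)
  qed
  have bound: "\<bar>conj j x\<bar> < real k + 4" if j: "j \<in> {0, 1, 2}" for j
  proof (rule ccontr)
    define y where "y = \<bar>conj j x\<bar>"
    assume "\<not> ?thesis"
    then have y: "real k + 4 \<le> y" unfolding y_def by simp
    have "y ^ 3 = \<bar>of_nat k * (conj j x)\<^sup>2 + of_nat (k + 3) * conj j x + 1\<bar>"
      unfolding conj_root[OF j, symmetric] y_def by (simp add: power_abs)
    also have "\<dots> \<le> real k * y\<^sup>2 + (real k + 3) * y + 1"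
      unfolding y_def by (intro abs_triangle_ineq[THEN order_trans] add_mono) (auto simp: abs_mult)
    finally have "y ^ 3 \<le> real k * y\<^sup>2 + (real k + 3) * y + 1" .
    moreover have "(real k + 4) * y\<^sup>2 \<le> y ^ 3"
      using y by (simp add: power3_eq_cube power2_eq_square mult_right_mono)
    moreover have "(real k + 4) * y \<le> y\<^sup>2" using y by (simp add: power2_eq_square mult_right_mono)
    \<comment> \<open>The two bounds give y^3 >= k y^2 + 4(k + 4) y, more than the upper bound k y^2
      + (k + 3) y + 1 allows.\<close>
    ultimately show False using y by (simp add: algebra_simps) (smt (verit) of_nat_0_le_iff mult_nonneg_nonneg)
  qed
  have "disc x \<noteq> 0"
  proof
    assume "disc x = 0"
    then have eq: "conj 0 x = conj 1 x" "conj 0 x = conj 2 x" unfolding disc_eq_0 by auto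
    obtain u v w where c: "coord x = (u, v, w)" by (cases "coord x")
    \<comment> \<open>If the conjugates coincide, they equal a third of the trace, which is
      rational. An integral root divides 1, and neither 1 nor -1 is a root.\<close>
    have "conj 0 x + conj 1 x + conj 2 x = of_rat (3 * u + 2 * of_int P * w)"
      unfolding conj_def c ev.simps by (simp add: of_rat_add of_rat_mult \<theta>_sums algebra_simps power2_eq_square)
    then have "conj 0 x = of_rat (3 * u + 2 * of_int P * w) / 3" using eq by simp
    then have "conj 0 x \<in> \<rat>" by (simp only: Rats_of_rat Rats_divide Rats_number_of)
    moreover have "algebraic_int (conj 0 x)" using algebraic_int_s xO by simp
    ultimately have "conj 0 x \<in> \<int>" using rational_algebraic_int_is_int by blast
    then obtain m where "conj 0 x = of_int m" by (auto elim: Ints_cases)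
    then have "(of_int (m ^ 3) :: real) = of_int (int k * m\<^sup>2 + int (k + 3) * m + 1)"
      using conj_root[of 0] by simp
    then have m: "m ^ 3 = int k * m\<^sup>2 + int (k + 3) * m + 1" unfolding of_int_eq_iff .
    then have "m * (m\<^sup>2 - int k * m - int (k + 3)) = 1"
      by (simp add: algebra_simps power2_eq_square power3_eq_cube)
    then have "m = 1 \<or> m = - 1" using zmult_eq_1_iff by blast
    then show False using m by auto
  qed
  then have "of_int p \<le> disc x" by (rule disc_ge[OF xO])
  also have "disc x \<le> (4 * (real k + 4)\<^sup>2 + 4 * (real k + 4)\<^sup>2 + 4 * (real k + 4)\<^sup>2) / 2"
  proof -
    have "(conj j x - conj j' x)\<^sup>2 \<le> 4 * (real k + 4)\<^sup>2" if "j \<in> {0, 1, 2}" "j' \<in> {0, 1, 2}" for j j'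
    proof -
      have "\<bar>conj j x - conj j' x\<bar> \<le> \<bar>conj j x\<bar> + \<bar>conj j' x\<bar>" by (rule abs_triangle_ineq4)
      also have "\<dots> \<le> (real k + 4) + (real k + 4)"
        by (rule add_mono; rule less_imp_le; rule bound; fact)
      finally have "\<bar>conj j x - conj j' x\<bar> \<le> 2 * (real k + 4)" by simp
      then have "\<bar>conj j x - conj j' x\<bar>\<^sup>2 \<le> (2 * (real k + 4))\<^sup>2" by (intro power_mono) auto
      then show ?thesis unfolding power_mult_distrib power2_abs by simp
    qed
    then show ?thesis unfolding disc_eq by (intro divide_right_mono add_mono) auto
  qed
  also have "\<dots> = of_int (6 * (int k + 4)\<^sup>2)" by simp
  finally show ?thesis unfolding of_int_le_iff .
qed

end

section \<open>Infinitely many fields\<close>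

definition field_hom :: "complex set \<Rightarrow> complex set \<Rightarrow> (complex \<Rightarrow> complex) \<Rightarrow> bool" where
  "field_hom K L h \<longleftrightarrow> h 1 = 1 \<and> (\<forall>x\<in>K. h x \<in> L \<and> (\<forall>y\<in>K. h (x + y) = h x + h y \<and> h (x * y) = h x * h y))"

lemma field_hom_of_nat:
  assumes "field_hom K L h" "subfield K complex_ring"
  shows "of_nat n \<in> K \<and> h (of_nat n) = of_nat n"
proof (induction n)
  case 0
  have "h (0 + 0) = h 0 + h 0"
    using assms subfield_complex_closed(1) unfolding field_hom_def by blast
  then show ?case using subfield_complex_closed(1)[OF assms(2)] by simp
next
  case (Suc n)
  then show ?case
    using assms(1) subfield_complex_closed[OF assms(2)] unfolding field_hom_def by simp
qed

lemma field_hom_of_iso: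
  assumes "field_ring K \<simeq> field_ring L"
  shows "\<exists>h. field_hom K L h"
proof -
  obtain h where "h \<in> ring_iso (field_ring K) (field_ring L)"
    using assms unfolding is_ring_iso_def by blast
  then have "field_hom K L h"
    unfolding field_hom_def using ring_iso_memE[of h "field_ring K" "field_ring L"]
    by (simp add: complex_ring_simps)
  then show ?thesis by blast
qed

text \<open>The least index \<open>k\<close> with \<open>has_root K k\<close> is an isomorphism invariant, and it takes
  arbitrarily large values.\<close>

lemma infinitely_many_fieldsI:
  fixes has_root :: "complex set \<Rightarrow> nat \<Rightarrow> bool"
  assumes fields: "\<And>n. \<exists>K. subfield K complex_ring \<and> P K \<and> (\<exists>k. has_root K k) \<and>
      (\<forall>k. has_root K k \<longrightarrow> n < k)"
    and transfer: "\<And>K L h k. field_hom K L h \<Longrightarrow> subfield K complex_ring \<Longrightarrow> has_root K k \<Longrightarrow> has_root L k"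
  shows "infinitely_many_fields P"
proof -
  define good where "good K \<longleftrightarrow> subfield K complex_ring \<and> P K \<and> (\<exists>k. has_root K k)" for K
  define I where "I K = (LEAST k. has_root K k)" for K
  have large: "\<exists>K. good K \<and> n < I K" for n
  proof -
    obtain K where K: "good K" "\<forall>k. has_root K k \<longrightarrow> n < k"
      using fields[of n] unfolding good_def by blast
    then have "has_root K (I K)" unfolding I_def good_def using LeastI_ex by blast
    then show ?thesis using K by blast
  qed
  then have "\<forall>m. \<exists>n>m. n \<in> I ` Collect good" by blast
  then have "infinite (I ` Collect good)" unfolding infinite_nat_iff_unbounded .
  \<comment> \<open>One field is kept for each value of the invariant, so \<open>I\<close> separates
    distinct members.\<close>
  obtain F where F: "F \<subseteq> Collect good" "I ` Collect good = I ` F" "inj_on I F"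
    using subset_image_inj[of "I ` Collect good" I "Collect good"] by auto
  have "infinite F" using \<open>infinite (I ` Collect good)\<close> F(2) by auto
  moreover have "\<forall>K\<in>F. P K" using F(1) unfolding good_def by blast
  moreover have "pairwise (\<lambda>K L. \<not> field_ring K \<simeq> field_ring L) F"
  proof (rule pairwiseI, rule notI)
    fix K L assume KL: "K \<in> F" "L \<in> F" "K \<noteq> L" and iso: "field_ring K \<simeq> field_ring L"
    have sub: "subfield K complex_ring" "subfield L complex_ring"
      using KL F(1) unfolding good_def by auto
    have "ring (field_ring K)"
      using ring.subring_is_ring[OF ring_from_type_algebra subfieldE(1)[OF sub(1)]] .
    then have "field_ring L \<simeq> field_ring K" using ring_iso_sym iso by blast
    then have "has_root K k \<longleftrightarrow> has_root L k" for k
      using field_hom_of_iso iso transfer sub by metis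
    then have "has_root K = has_root L" by (rule ext)
    then have "I K = I L" unfolding I_def by simp
    then show False using F(3) KL by (auto dest: inj_onD)
  qed
  ultimately show ?thesis unfolding infinitely_many_fields_def by blast
qed

section \<open>Choice of the parameters\<close>

text \<open>Euclid's argument: \<open>f (fact n)\<close> exceeds 1 and is congruent to 1 modulo
  every prime up to \<open>n\<close>.\<close>

lemma large_prime_divisor:
  fixes f :: "nat \<Rightarrow> nat"
  assumes "\<And>x. f x = x * g x + 1" "\<And>x. x > 0 \<Longrightarrow> g x > 0"
  shows "\<exists>x p. prime p \<and> n < p \<and> p dvd f x"
proof -
  have "f (fact n) \<noteq> 1" using assms(1)[of "fact n"] assms(2)[of "fact n"] by simp
  then obtain p where p: "prime p" "p dvd f (fact n)" using prime_factor_nat by blast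
  have "\<not> p \<le> n"
  proof
    assume "p \<le> n"
    then have "p dvd fact n" by (rule dvd_fact[OF prime_ge_1_nat[OF p(1)]])
    then have "p dvd fact n * g (fact n)" by simp
    then have "p dvd 1" using p(2) unfolding assms(1) by (metis dvd_add_right_iff)
    then show False using p(1) by simp
  qed
  then have "n < p" by simp
  then show ?thesis using p by blast
qed

text \<open>If p^2 divides x^2 + 1, pass to x + p: modulo p^2 the value changes by 2 x p, and 2 x is
  prime to \<open>p\<close> since \<open>p\<close> is odd and divides x^2 + 1. The offset 2 makes
  \<open>p\<close> odd.\<close>

lemma exists_quadratic_parameters:
  "\<exists>q p :: int. 0 < q \<and> prime p \<and> int n < p \<and> p dvd q\<^sup>2 + 1 \<and> \<not> p\<^sup>2 dvd q\<^sup>2 + 1"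
proof -
  obtain x p :: nat where p: "prime p" "n + 2 < p" "p dvd x * x + 1"
    using large_prime_divisor[of "\<lambda>x. x * x + 1" "\<lambda>x. x" "n + 2"] by auto
  have x: "x > 0" using p by (intro Nat.gr0I) auto
  have "int p dvd int (x * x + 1)" unfolding int_dvd_int_iff by (rule p(3))
  then have P: "prime (int p)" "int p > 2" "int p dvd (int x)\<^sup>2 + 1"
    using p(1,2) by (simp_all add: power2_eq_square add.commute)
  show ?thesis
  proof (cases "(int p)\<^sup>2 dvd (int x)\<^sup>2 + 1")
    case False
    then show ?thesis using P p(2) x by (intro exI[of _ "int x"] exI[of _ "int p"]) auto
  next
    case True
    have eq: "(int x + int p)\<^sup>2 + 1 = ((int x)\<^sup>2 + 1) + int p * (2 * int x + int p)"
      by (simp add: power2_eq_square algebra_simps)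
    have "\<not> (int p)\<^sup>2 dvd (int x + int p)\<^sup>2 + 1"
    proof
      assume "(int p)\<^sup>2 dvd (int x + int p)\<^sup>2 + 1"
      then have "int p * int p dvd int p * (2 * int x + int p)"
        using True unfolding eq by (simp add: dvd_add_right_iff power2_eq_square)
      then have "int p dvd 2 * int x" using P(2) by simp
      moreover have "\<not> int p dvd 2" using zdvd_imp_le[of "int p" 2] P(2) by linarith
      ultimately have "int p dvd int x" using prime_dvd_multD[OF P(1)] by blast
      then have "int p dvd (int x)\<^sup>2" by (simp add: power2_eq_square)
      then have "int p dvd 1" using P(3) by (metis dvd_add_right_iff)
      then show False using P(1) not_prime_unit by blast
    qed
    moreover have "int p dvd (int x + int p)\<^sup>2 + 1" unfolding eq using P(3) by simp
    ultimately show ?thesis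
      using P p(2) x by (intro exI[of _ "int x + int p"] exI[of _ "int p"]) auto
  qed
qed

text \<open>The substitution a = 3x turns the polynomial into 9(x^2 + x + 1), to which Euclid's
  argument applies. If p^2 divides the value, pass to a + p; the derivative 2a + 3 is prime to
  \<open>p\<close> because \<open>p\<close> exceeds 3.\<close>

lemma exists_cubic_parameters:
  "\<exists>a p :: int. 0 \<le> a \<and> prime p \<and> 3 < p \<and> int n < p \<and> p dvd a\<^sup>2 + 3 * a + 9 \<and> \<not> p\<^sup>2 dvd a\<^sup>2 + 3 * a + 9"
proof -
  obtain x p :: nat where p: "prime p" "n + 3 < p" "p dvd x * (x + 1) + 1"
    using large_prime_divisor[of "\<lambda>x. x * (x + 1) + 1" "\<lambda>x. x + 1" "n + 3"] by auto
  define a where "a = 3 * int x"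
  have P: "prime (int p)" "int p > 3" using p by auto
  have "int p dvd int (9 * (x * (x + 1) + 1))" unfolding int_dvd_int_iff using p(3) by (rule dvd_mult)
  also have "int (9 * (x * (x + 1) + 1)) = a\<^sup>2 + 3 * a + 9"
    by (simp add: a_def power2_eq_square algebra_simps)
  finally have div: "int p dvd a\<^sup>2 + 3 * a + 9" .
  show ?thesis
  proof (cases "(int p)\<^sup>2 dvd a\<^sup>2 + 3 * a + 9")
    case False
    then show ?thesis using P p(2) div by (intro exI[of _ a] exI[of _ "int p"]) (auto simp: a_def)
  next
    case True
    have eq: "(a + int p)\<^sup>2 + 3 * (a + int p) + 9 = (a\<^sup>2 + 3 * a + 9) + int p * ((2 * a + 3) + int p)"
      by (simp add: power2_eq_square algebra_simps)
    have "\<not> (int p)\<^sup>2 dvd (a + int p)\<^sup>2 + 3 * (a + int p) + 9"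
    proof
      assume "(int p)\<^sup>2 dvd (a + int p)\<^sup>2 + 3 * (a + int p) + 9"
      then have "(int p)\<^sup>2 dvd int p * ((2 * a + 3) + int p)"
        using True unfolding eq by (simp only: dvd_add_right_iff)
      then have "int p dvd (2 * a + 3) + int p" using P(2) by (simp add: power2_eq_square)
      then have "int p dvd 2 * a + 3" by (simp only: dvd_add_left_iff[OF dvd_refl])
      then have "int p dvd (2 * a + 3)\<^sup>2" by (simp add: power2_eq_square)
      moreover have "int p dvd 4 * (a\<^sup>2 + 3 * a + 9)" using div by (rule dvd_mult)
      ultimately have "int p dvd 4 * (a\<^sup>2 + 3 * a + 9) - (2 * a + 3)\<^sup>2" by (rule dvd_diff[rotated])
      also have "4 * (a\<^sup>2 + 3 * a + 9) - (2 * a + 3)\<^sup>2 = 3 ^ 3" by (simp add: power2_eq_square algebra_simps)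
      finally have "int p dvd 3" using P(1) prime_dvd_power by blast
      then show False using P(2) zdvd_imp_le[of "int p" 3] by linarith
    qed
    moreover have "int p dvd (a + int p)\<^sup>2 + 3 * (a + int p) + 9" unfolding eq using div by simp
    ultimately show ?thesis
      using P p(2) by (intro exI[of _ "a + int p"] exI[of _ "int p"]) (auto simp: a_def)
  qed
qed

text \<open>The cubic changes sign between consecutive points among -2, -1, 0 and a + 2, with values
  1 at -1 and -1 at 0.\<close>

lemma simplest_cubic_roots:
  fixes a :: int
  assumes "0 \<le> a"
  obtains \<rho> :: "nat \<Rightarrow> real" where
    "\<And>j. j \<in> {0, 1, 2} \<Longrightarrow> \<rho> j ^ 3 = of_int a * (\<rho> j)\<^sup>2 + of_int (a + 3) * \<rho> j + 1"
    "\<rho> 0 < - 1" "- 1 < \<rho> 1" "\<rho> 1 < 0" "0 < \<rho> 2"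
proof -
  define f :: "real \<Rightarrow> real" where "f t = t ^ 3 - of_int a * t\<^sup>2 - of_int (a + 3) * t - 1" for t
  have cont: "continuous_on A f" for A unfolding f_def by (intro continuous_intros)
  have a: "0 \<le> real_of_int a" using assms by simp
  have vals: "f (- 2) < 0" "f (- 1) > 0" "f 0 < 0"
    using a unfolding f_def by (simp_all add: power2_eq_square power3_eq_cube algebra_simps)
  have "f (of_int a + 2) = (of_int a + 2) * (of_int a + 1) - 1"
    unfolding f_def by (simp add: power2_eq_square power3_eq_cube algebra_simps)
  also have "\<dots> = of_int a * of_int a + 3 * of_int a + 1" by (simp add: algebra_simps)
  also have "\<dots> > 0" using a by (intro add_nonneg_pos add_nonneg_nonneg mult_nonneg_nonneg) auto
  finally have val: "f (of_int a + 2) > 0" .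
  obtain u where u: "u \<le> - 1" "f u = 0" using IVT'[of f "- 2" 0 "- 1"] vals cont by force
  obtain v where v: "- 1 \<le> v" "v \<le> 0" "f v = 0" using IVT2'[of f 0 0 "- 1"] vals cont by force
  obtain w where w: "0 \<le> w" "f w = 0" using IVT'[of f 0 0 "of_int a + 2"] vals val a cont by force
  have strict: "u \<noteq> - 1" "v \<noteq> - 1" "v \<noteq> 0" "w \<noteq> 0" using u v w vals by auto
  define \<rho> where "\<rho> j = (if j = 0 then u else if j = 1 then v else w)" for j :: nat
  show thesis
  proof (rule that[of \<rho>])
    fix j :: nat assume "j \<in> {0, 1, 2}"
    have "f (\<rho> j) = 0" unfolding \<rho>_def using u v w by simp
    then show "\<rho> j ^ 3 = of_int a * (\<rho> j)\<^sup>2 + of_int (a + 3) * \<rho> j + 1" unfolding f_def by simp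
  qed (use u v w strict in \<open>auto simp: \<rho>_def\<close>)
qed

section \<open>The two families of fields\<close>

lemma no_universal_form_of_rank:
  assumes "\<And>a. \<not> universal_form K (nat r) a"
  shows "\<not> has_universal_form_of_rank K r"
  using assms unfolding has_universal_form_of_rank_def by auto

text \<open>The isomorphism invariant is the least positive \<open>k\<close> for which k^2 + 1 is a
  square in the field; \<open>q\<close> is one such \<open>k\<close>. The value k = 0 is excluded
  since 1 is a square in every field.\<close>

lemma quadratic_fields:
  "infinitely_many_fields (\<lambda>K. number_field_of_degree 2 K \<and> totally_real K \<and>
     \<not> has_universal_form_of_rank K r)"
proof (rule infinitely_many_fieldsI[where has_root = "\<lambda>K k. k > 0 \<and> (\<exists>x\<in>K. x\<^sup>2 = of_nat (k\<^sup>2 + 1))"])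
  fix n :: nat
  define N where "N = 9 ^ nat r + (1 :: nat)"
  \<comment> \<open>The summand \<open>N^2\<close> makes \<open>p\<close> large enough to exclude
    universal forms; the other one excludes square roots of k^2 + 1 with k <= n through
    \<open>Q.root_bound\<close>.\<close>
  obtain q p :: int where q: "0 < q" and p: "prime p" "int (N\<^sup>2 + 4 * (n\<^sup>2 + 1)) < p"
    "p dvd q\<^sup>2 + 1" "\<not> p\<^sup>2 dvd q\<^sup>2 + 1"
    using exists_quadratic_parameters by blast
  interpret Q: real_quadratic q p by unfold_locales (use p in auto)
  have "int (N\<^sup>2) \<le> int (N\<^sup>2 + 4 * (n\<^sup>2 + 1))" by simp
  then have "int (N\<^sup>2) < p" using p(2) by (rule le_less_trans)
  then have univ: "\<not> universal_form Q.K (nat r) a" for a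
    by (intro Q.no_universal_form_if_large[of _ N]) (simp_all add: N_def)
  have large: "n < k" if "0 < k" "x \<in> Q.K" "x\<^sup>2 = of_nat (k\<^sup>2 + 1)" for k x
  proof (rule ccontr)
    assume "\<not> n < k"
    then have "k\<^sup>2 \<le> n\<^sup>2" by (intro power_mono) auto
    then have "int (4 * (k\<^sup>2 + 1)) \<le> int (N\<^sup>2 + 4 * (n\<^sup>2 + 1))"
      by (intro of_nat_mono trans_le_add2) simp
    then have "int (4 * (k\<^sup>2 + 1)) < p" using p(2) by (rule le_less_trans)
    then show False using Q.root_bound[OF that(2,3,1)] by simp
  qed
  have root: "\<exists>x\<in>Q.K. x\<^sup>2 = of_nat ((nat q)\<^sup>2 + 1)"
  proof (rule bexI)
    have "(complex_of_real (Q.ev 0 (0, 1)))\<^sup>2 = complex_of_real (Q.w * Q.w)"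
      by (simp add: power2_eq_square)
    also have "\<dots> = of_nat ((nat q)\<^sup>2 + 1)" unfolding Q.w_square using q by simp
    finally show "(complex_of_real (Q.ev 0 (0, 1)))\<^sup>2 = of_nat ((nat q)\<^sup>2 + 1)" .
  qed (rule Q.elem_in_K)
  show "\<exists>K. subfield K complex_ring \<and>
      (number_field_of_degree 2 K \<and> totally_real K \<and> \<not> has_universal_form_of_rank K r) \<and>
      (\<exists>k. k > 0 \<and> (\<exists>x\<in>K. x\<^sup>2 = of_nat (k\<^sup>2 + 1))) \<and>
      (\<forall>k. k > 0 \<and> (\<exists>x\<in>K. x\<^sup>2 = of_nat (k\<^sup>2 + 1)) \<longrightarrow> n < k)"
  proof (intro exI[of _ Q.K] conjI)
    show "\<exists>k. k > 0 \<and> (\<exists>x\<in>Q.K. x\<^sup>2 = of_nat (k\<^sup>2 + 1))"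
      using root q by (intro exI[of _ "nat q"] conjI) simp_all
    show "\<forall>k. k > 0 \<and> (\<exists>x\<in>Q.K. x\<^sup>2 = of_nat (k\<^sup>2 + 1)) \<longrightarrow> n < k"
      using large by blast
  qed (rule Q.subfield_K Q.degree Q.totally_real no_universal_form_of_rank[OF univ])+
next
  fix K L h and k :: nat
  assume h: "field_hom K L h" "subfield K complex_ring"
    and "k > 0 \<and> (\<exists>x\<in>K. x\<^sup>2 = of_nat (k\<^sup>2 + 1))"
  then obtain x where x: "x \<in> K" "x\<^sup>2 = of_nat (k\<^sup>2 + 1)" and "k > 0" by blast
  have "h (x * x) = of_nat (k\<^sup>2 + 1)"
    using field_hom_of_nat[OF h] x(2) by (metis power2_eq_square)
  moreover have "h (x * x) = h x * h x" "h x \<in> L" using h(1) x(1) unfolding field_hom_def by auto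
  ultimately show "k > 0 \<and> (\<exists>x\<in>L. x\<^sup>2 = of_nat (k\<^sup>2 + 1))"
    using \<open>k > 0\<close> by (metis power2_eq_square)
qed

text \<open>The isomorphism invariant is the least \<open>k\<close> for which the simplest cubic
  with parameter \<open>k\<close> has a root in the field; \<open>a\<close> is one such
  parameter.\<close>

lemma cubic_fields:
  "infinitely_many_fields (\<lambda>K. number_field_of_degree 3 K \<and> totally_real K \<and>
     \<not> has_universal_form_of_rank K r)"
proof (rule infinitely_many_fieldsI[where has_root =
      "\<lambda>K k. \<exists>x\<in>K. x ^ 3 = of_nat k * x\<^sup>2 + of_nat (k + 3) * x + 1"])
  fix n :: nat
  define N where "N = 27 ^ nat r + (1 :: nat)"
  \<comment> \<open>The summand \<open>3 * N^2\<close> excludes universal forms, and the other one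
    excludes roots for parameters up to \<open>n\<close> through
    \<open>C.root_bound\<close>.\<close>
  obtain a p :: int where a: "0 \<le> a" and p: "prime p" "3 < p" "int (3 * N\<^sup>2 + 6 * (n + 4)\<^sup>2) < p"
    "p dvd a\<^sup>2 + 3 * a + 9" "\<not> p\<^sup>2 dvd a\<^sup>2 + 3 * a + 9"
    using exists_cubic_parameters by blast
  obtain \<rho> :: "nat \<Rightarrow> real" where \<rho>:
    "\<And>j. j \<in> {0, 1, 2} \<Longrightarrow> \<rho> j ^ 3 = of_int a * (\<rho> j)\<^sup>2 + of_int (a + 3) * \<rho> j + 1"
    "\<rho> 0 < - 1" "- 1 < \<rho> 1" "\<rho> 1 < 0" "0 < \<rho> 2"
    using simplest_cubic_roots[OF a] by blast
  interpret C: simplest_cubic a p \<rho> by unfold_locales (use p \<rho> in auto)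
  have "3 * int (N\<^sup>2) \<le> int (3 * N\<^sup>2 + 6 * (n + 4)\<^sup>2)" by simp
  then have "3 * int (N\<^sup>2) < p" using p(3) by (rule le_less_trans)
  then have univ: "\<not> universal_form C.K (nat r) form" for form
    by (intro C.no_universal_form_if_large[of _ N]) (simp_all add: N_def)
  have large: "n < k" if "x \<in> C.K" "x ^ 3 = of_nat k * x\<^sup>2 + of_nat (k + 3) * x + 1" for k x
  proof (rule ccontr)
    assume "\<not> n < k"
    then have "(k + 4)\<^sup>2 \<le> (n + 4)\<^sup>2" by (intro power_mono) auto
    then have "int (6 * (k + 4)\<^sup>2) \<le> int (3 * N\<^sup>2 + 6 * (n + 4)\<^sup>2)"
      by (intro of_nat_mono trans_le_add2) simp
    then have "int (6 * (k + 4)\<^sup>2) < p" using p(3) by (rule le_less_trans)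
    then show False using C.root_bound[OF that] by simp
  qed
  have root: "\<exists>x\<in>C.K. x ^ 3 = of_nat (nat a) * x\<^sup>2 + of_nat (nat a + 3) * x + 1"
    using C.r0_root C.O_closed(1)[OF C.r0_O] a by (intro bexI[of _ C.r0]) auto
  show "\<exists>K. subfield K complex_ring \<and>
      (number_field_of_degree 3 K \<and> totally_real K \<and> \<not> has_universal_form_of_rank K r) \<and>
      (\<exists>k. \<exists>x\<in>K. x ^ 3 = of_nat k * x\<^sup>2 + of_nat (k + 3) * x + 1) \<and>
      (\<forall>k. (\<exists>x\<in>K. x ^ 3 = of_nat k * x\<^sup>2 + of_nat (k + 3) * x + 1) \<longrightarrow> n < k)"
  proof (intro exI[of _ C.K] conjI)
    show "\<exists>k. \<exists>x\<in>C.K. x ^ 3 = of_nat k * x\<^sup>2 + of_nat (k + 3) * x + 1"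
      using root by (rule exI)
    show "\<forall>k. (\<exists>x\<in>C.K. x ^ 3 = of_nat k * x\<^sup>2 + of_nat (k + 3) * x + 1) \<longrightarrow> n < k"
      using large by blast
  qed (rule C.subfield_K C.degree C.totally_real no_universal_form_of_rank[OF univ])+
next
  fix K L h and k :: nat
  assume h: "field_hom K L h" "subfield K complex_ring"
    and "\<exists>x\<in>K. x ^ 3 = of_nat k * x\<^sup>2 + of_nat (k + 3) * x + 1"
  then obtain x where x: "x \<in> K" "x ^ 3 = of_nat k * x\<^sup>2 + of_nat (k + 3) * x + 1" by blast
  note closed = subfield_complex_closed[OF h(2)]
  have hom: "h (u + v) = h u + h v" "h (u * v) = h u * h v" if "u \<in> K" "v \<in> K" for u v
    using h(1) that unfolding field_hom_def by auto
  have nat: "of_nat m \<in> K" "h (of_nat m) = of_nat m" for m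
    using field_hom_of_nat[OF h] by auto
  have "x * (x * x) = of_nat k * (x * x) + of_nat (k + 3) * x + 1"
    using x(2) by (simp add: power2_eq_square power3_eq_cube mult.assoc)
  then have "h (x * (x * x)) = h (of_nat k * (x * x) + of_nat (k + 3) * x + 1)" by simp
  then have "h x * (h x * h x) = of_nat k * (h x * h x) + of_nat (k + 3) * h x + 1"
    using hom nat closed x(1) h(1) unfolding field_hom_def by (simp del: of_nat_add)
  moreover have "h x \<in> L" using h(1) x(1) unfolding field_hom_def by blast
  ultimately show "\<exists>x\<in>L. x ^ 3 = of_nat k * x\<^sup>2 + of_nat (k + 3) * x + 1"
    by (intro bexI[of _ "h x"]) (simp_all add: power2_eq_square power3_eq_cube mult.assoc)
qed

theorem theorem5:
  fixes r :: int
  shows "infinitely_many_fields (\<lambda>K. number_field_of_degree 2 K \<and> totally_real K \<and>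
           \<not> has_universal_form_of_rank K r) \<and>
         infinitely_many_fields (\<lambda>K. number_field_of_degree 3 K \<and> totally_real K \<and>
           \<not> has_universal_form_of_rank K r)"
  using quadratic_fields cubic_fields by blast

end
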